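(* Let $B_X$ be the open unit ball of a complex Banach space $X$, let $F:B_X\to\overline{\mathbb{U}}$ be a holomorphic mapping with $$F(z)=a+\sum_{s=1}^{\infty}P_s(z),\qquad z\in B_X,$$ where $P_s(z)=\frac{1}{s!}D^sF(0)(z^s)$, and let $\mu_m:B_X\to B_X$ be a Schwarz mapping having $z=0$ as a zero of order $m$. Then, for each $N,m\in\mathbb{N}$, the inequality $$|F(\mu_m(z))|+\sum_{k=N}^{\infty}\left|\frac{D^kF(\mu_m(z))\bigl((\mu_m(z))^k\bigr)}{k!}\right|\le 1$$ holds for all $z\in B_X$ with $\|z\|=r\le R_{3,m,N}$, where $R_{3,m,N}\in(0,1)$ is the smallest positive root of the equation $$2r^{mN}-(1-r^m)^{N-1}(1+r^m)(1-2r^m)=0.$$ The number $R_{3,m,N}$ cannot be improved, that is, for given $m,N$ it cannot be replaced by any larger number so that the inequality remains valid for all such $F,\mu_m$ and $z$.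
   Context: $\mathbb{U}=\{\zeta\in\mathbb{C}:|\zeta|<1\}$ and $\overline{\mathbb{U}}$ is its closure. For a holomorphic mapping $F$ between (open subsets of) complex Banach spaces, $D^kF(z)$ denotes the $k$-th Fréchet derivative of $F$ at $z$ (a symmetric $k$-linear map), and $D^kF(z)(w^k)$ means $D^kF(z)(w,\ldots,w)$ with $w$ repeated $k$ times. Thus $P_s$ is the $s$-homogeneous polynomial in the Taylor expansion of $F$ at $0$, and $a=F(0)$. For $m\in\mathbb{N}=\{1,2,\ldots\}$, $z=0$ is a zero of order $m$ of a holomorphic mapping $\mu$ if $\mu(0)=0$, $D\mu(0)=0,\ldots,D^{m-1}\mu(0)=0$, but $D^m\mu(0)\ne0$. A Schwarz mapping $\mu:B_X\to B_X$ is a holomorphic mapping with $\mu(0)=0$. A divergent series of nonnegative terms is assigned the value $+\infty$. *)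

theory Defs
  imports "HOL-Analysis.Analysis"
begin

section \<open>Complex Banach spaces\<close>

class complex_normed_vector = real_normed_vector +
  fixes scaleC :: "complex \<Rightarrow> 'a \<Rightarrow> 'a"  (infixr \<open>*\<^sub>C\<close> 75)
  assumes scaleC_add_right: "c *\<^sub>C (x + y) = c *\<^sub>C x + c *\<^sub>C y"
    and scaleC_add_left: "(c + d) *\<^sub>C x = c *\<^sub>C x + d *\<^sub>C x"
    and scaleC_scaleC: "c *\<^sub>C (d *\<^sub>C x) = (c * d) *\<^sub>C x"
    and scaleC_of_real: "complex_of_real r *\<^sub>C x = r *\<^sub>R x"
    and norm_scaleC: "norm (c *\<^sub>C x) = cmod c * norm x"

lemma scaleC_one: "1 *\<^sub>C (x :: 'a::complex_normed_vector) = x"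
  using scaleC_of_real[of 1 x] by simp

class complex_banach = complex_normed_vector + banach

instantiation complex :: complex_banach
begin

definition scaleC_complex :: "complex \<Rightarrow> complex \<Rightarrow> complex"
  where "scaleC_complex c x = c * x"

instance
  by standard (auto simp: scaleC_complex_def algebra_simps norm_mult scaleR_conv_of_real)

end

section \<open>Holomorphic mappings and higher Frechet derivatives\<close>

definition holomorphic_map_on ::
    "('a::complex_banach \<Rightarrow> 'b::complex_banach) \<Rightarrow> 'a set \<Rightarrow> bool" where
  "holomorphic_map_on F U \<longleftrightarrow>
     (\<forall>z\<in>U. \<exists>L. (F has_derivative L) (at z) \<and> (\<forall>c x. L (c *\<^sub>C x) = c *\<^sub>C L x))"

text \<open>A \<open>k\<close>-linear map is represented by a function on lists, of which only the values
  on lists of length \<open>k\<close> are relevant.\<close>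

definition bounded_cmultilinear ::
    "nat \<Rightarrow> ('a::complex_banach list \<Rightarrow> 'b::complex_banach) \<Rightarrow> bool" where
  "bounded_cmultilinear k M \<longleftrightarrow>
     (\<forall>xs ys u v c. length xs + 1 + length ys = k \<longrightarrow>
        M (xs @ (u + v) # ys) = M (xs @ u # ys) + M (xs @ v # ys) \<and>
        M (xs @ (c *\<^sub>C u) # ys) = c *\<^sub>C M (xs @ u # ys)) \<and>
     (\<exists>K. \<forall>ws. length ws = k \<longrightarrow> norm (M ws) \<le> K * (\<Prod>w\<leftarrow>ws. norm w))"

text \<open>Frechet differentiability at \<open>z\<close> of a map \<open>G\<close> into the space of bounded \<open>k\<close>-linear maps.
  The derivative, a bounded linear map into that space, is identified with the
  bounded \<open>(k + 1)\<close>-linear map \<open>L\<close> whose first argument is the increment.  Convergence in the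
  norm of \<open>k\<close>-linear maps is uniform convergence on \<open>k\<close>-tuples from the closed unit ball.\<close>

definition has_multi_derivative ::
    "nat \<Rightarrow> ('a::complex_banach \<Rightarrow> 'a list \<Rightarrow> 'b::complex_banach) \<Rightarrow> ('a list \<Rightarrow> 'b) \<Rightarrow> 'a \<Rightarrow> bool"
  where
  "has_multi_derivative k G L z \<longleftrightarrow>
     bounded_cmultilinear (Suc k) L \<and>
     uniform_limit {ws. length ws = k \<and> set ws \<subseteq> cball 0 1}
       (\<lambda>h ws. (G (z + h) ws - G z ws - L (h # ws)) /\<^sub>R norm h) (\<lambda>ws. 0) (at 0)"

text \<open>\<open>nth_frechet k F z [w\<^sub>1, \<dots>, w\<^sub>k]\<close> is \<open>D\<^sup>kF(z)(w\<^sub>1, \<dots>, w\<^sub>k)\<close>.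
  As for \<^const>\<open>frechet_derivative\<close>, the value is meaningful only if the derivative exists;
  it is then unique on lists of length \<open>k\<close>, see \<open>has_multi_derivative_unique\<close> below.\<close>

primrec nth_frechet ::
    "nat \<Rightarrow> ('a::complex_banach \<Rightarrow> 'b::complex_banach) \<Rightarrow> 'a \<Rightarrow> 'a list \<Rightarrow> 'b" where
  "nth_frechet 0 F = (\<lambda>z ws. F z)"
| "nth_frechet (Suc k) F = (\<lambda>z. SOME L. has_multi_derivative k (nth_frechet k F) L z)"

lemma bounded_cmultilinearD:
  assumes "bounded_cmultilinear k M" "length xs + 1 + length ys = k"
  shows "M (xs @ (u + v) # ys) = M (xs @ u # ys) + M (xs @ v # ys)"
    and "M (xs @ (c *\<^sub>C u) # ys) = c *\<^sub>C M (xs @ u # ys)"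
  using assms unfolding bounded_cmultilinear_def by blast+

lemma has_multi_derivative_imp_has_derivative:
  assumes "has_multi_derivative k G L z" "length ws = k" "set ws \<subseteq> cball 0 1"
  shows "((\<lambda>x. G x ws) has_derivative (\<lambda>h. L (h # ws))) (at z)"
proof -
  have ml: "bounded_cmultilinear (Suc k) L"
    and ul: "uniform_limit {ws. length ws = k \<and> set ws \<subseteq> cball 0 1}
       (\<lambda>h ws. (G (z + h) ws - G z ws - L (h # ws)) /\<^sub>R norm h) (\<lambda>ws. 0) (at 0)"
    using assms(1) by (auto simp: has_multi_derivative_def)
  have lin: "L ((u + v) # ws) = L (u # ws) + L (v # ws)"
    "L ((c *\<^sub>C u) # ws) = c *\<^sub>C L (u # ws)" for u v c
    using bounded_cmultilinearD[OF ml, of "[]" ws] assms(2) by auto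
  obtain K where K: "\<And>vs. length vs = Suc k \<Longrightarrow> norm (L vs) \<le> K * (\<Prod>w\<leftarrow>vs. norm w)"
    using ml unfolding bounded_cmultilinear_def by blast
  have "bounded_linear (\<lambda>h. L (h # ws))"
  proof (rule bounded_linear_intro)
    fix r x
    show "L ((r *\<^sub>R x) # ws) = r *\<^sub>R L (x # ws)"
      using lin(2)[of "complex_of_real r"] by (simp add: scaleC_of_real)
    show "norm (L (x # ws)) \<le> norm x * (K * (\<Prod>w\<leftarrow>ws. norm w))"
      using K[of "x # ws"] assms(2) by (simp add: mult_ac)
  qed (rule lin(1))
  moreover have "((\<lambda>h. (G (z + h) ws - G z ws - L (h # ws)) /\<^sub>R norm h) \<longlongrightarrow> 0) (at 0)"
    using tendsto_uniform_limitI[OF ul, of ws] assms by simp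
  then have "((\<lambda>h. norm ((G (z + h) ws - G z ws - L (h # ws)) /\<^sub>R norm h)) \<longlongrightarrow> 0) (at 0)"
    by (rule tendsto_norm_zero)
  then have "((\<lambda>h. norm (G (z + h) ws - G z ws - L (h # ws)) / norm h) \<longlongrightarrow> 0) (at 0)"
    by (simp add: divide_inverse_commute)
  ultimately show ?thesis
    unfolding has_derivative_at by blast
qed

lemma has_multi_derivative_0_iff:
  "has_multi_derivative 0 (\<lambda>z ws. F z) L z \<longleftrightarrow>
     (F has_derivative (\<lambda>h. L [h])) (at z) \<and> (\<forall>c x. L [c *\<^sub>C x] = c *\<^sub>C L [x])"
  (is "?lhs \<longleftrightarrow> ?rhs")
proof
  assume l: ?lhs
  then have "L [c *\<^sub>C x] = c *\<^sub>C L [x]" for c x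
    using bounded_cmultilinearD[of "Suc 0" L "[]" "[]"] by (auto simp: has_multi_derivative_def)
  with has_multi_derivative_imp_has_derivative[OF l, of "[]"] show ?rhs by simp
next
  assume r: ?rhs
  then have bl: "bounded_linear (\<lambda>h. L [h])"
    and lim: "((\<lambda>h. norm (F (z + h) - F z - L [h]) / norm h) \<longlongrightarrow> 0) (at 0)"
    by (auto simp: has_derivative_at)
  obtain K where K: "norm (L [h]) \<le> norm h * K" for h
    using bounded_linear.bounded[OF bl] by blast
  have "bounded_cmultilinear (Suc 0) L"
    unfolding bounded_cmultilinear_def
  proof (intro conjI allI impI exI[of _ K])
    fix xs ys :: "'a list" and u v c
    assume "length xs + 1 + length ys = Suc 0"
    then have "xs = []" "ys = []" by auto
    then show "L (xs @ (u + v) # ys) = L (xs @ u # ys) + L (xs @ v # ys)"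
      "L (xs @ (c *\<^sub>C u) # ys) = c *\<^sub>C L (xs @ u # ys)"
      using r linear_add[OF bounded_linear.linear[OF bl]] by auto
  next
    fix ws :: "'a list" assume "length ws = Suc 0"
    then obtain w where "ws = [w]" by (auto simp: length_Suc_conv)
    then show "norm (L ws) \<le> K * (\<Prod>w\<leftarrow>ws. norm w)" using K[of w] by (simp add: mult.commute)
  qed
  moreover have "uniform_limit {ws. length ws = 0 \<and> set ws \<subseteq> cball 0 1}
       (\<lambda>h ws. (F (z + h) - F z - L (h # ws)) /\<^sub>R norm h) (\<lambda>ws. 0) (at 0)"
    using lim by (auto simp: uniform_limit_iff tendsto_iff divide_inverse_commute)
  ultimately show ?lhs by (simp add: has_multi_derivative_def)
qed

lemma bounded_cmultilinear_scaleC: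
  assumes "bounded_cmultilinear k M" "length us + length vs = k"
  shows "M (us @ map ((*\<^sub>C) c) vs) = c ^ length vs *\<^sub>C M (us @ vs)"
  using assms(2)
proof (induction vs arbitrary: us)
  case Nil
  then show ?case
    by (simp add: scaleC_one)
next
  case (Cons v vs)
  have "M (us @ map ((*\<^sub>C) c) (v # vs)) = c *\<^sub>C M ((us @ [v]) @ map ((*\<^sub>C) c) vs)"
    using bounded_cmultilinearD(2)[OF assms(1), of us "map ((*\<^sub>C) c) vs" c v] Cons.prems by simp
  also have "\<dots> = c *\<^sub>C c ^ length vs *\<^sub>C M ((us @ [v]) @ vs)"
    using Cons.prems by (subst Cons.IH) auto
  finally show ?case by (simp add: scaleC_scaleC)
qed

lemma has_multi_derivative_unique:
  assumes "has_multi_derivative k G L z" "has_multi_derivative k G M z" "length ws = Suc k"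
  shows "L ws = M ws"
proof -
  obtain h vs where ws: "ws = h # vs" and len: "length vs = k"
    using assms(3) by (auto simp: length_Suc_conv)
  define b where "b = 1 + (\<Sum>v\<leftarrow>vs. norm v)"
  have b: "b \<ge> 1" unfolding b_def by (auto intro!: sum_list_nonneg)
  have le: "norm v \<le> b" if "v \<in> set vs" for v
  proof -
    have "norm v \<le> (\<Sum>v\<leftarrow>vs. norm v)"
      using that by (intro member_le_sum_list) auto
    then show ?thesis by (simp add: b_def)
  qed
  define c where "c = complex_of_real (1 / b)"
  define us where "us = map ((*\<^sub>C) c) vs"
  have us: "length us = k" "set us \<subseteq> cball 0 1"
    using le b len by (auto simp: us_def c_def norm_scaleC norm_divide divide_simps)
  have "(\<lambda>h. L (h # us)) = (\<lambda>h. M (h # us))"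
    using has_multi_derivative_imp_has_derivative[OF assms(1) us]
      has_multi_derivative_imp_has_derivative[OF assms(2) us]
    by (rule has_derivative_unique)
  then have "L (h # us) = M (h # us)" by meson
  moreover have "L (h # us) = c ^ k *\<^sub>C L ws" "M (h # us) = c ^ k *\<^sub>C M ws"
    using bounded_cmultilinear_scaleC[of "Suc k" _ "[h]" vs c] assms len
    by (auto simp: us_def ws has_multi_derivative_def)
  ultimately have "inverse (c ^ k) *\<^sub>C c ^ k *\<^sub>C L ws = inverse (c ^ k) *\<^sub>C c ^ k *\<^sub>C M ws" by simp
  moreover have "c ^ k \<noteq> 0" using b by (simp add: c_def)
  ultimately show ?thesis
    by (simp add: scaleC_scaleC scaleC_one)
qed

section \<open>Schwarz mappings and the Bohr-type inequality\<close>

definition schwarz_mapping :: "('a::complex_banach \<Rightarrow> 'a) \<Rightarrow> bool" where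
  "schwarz_mapping \<mu> \<longleftrightarrow> holomorphic_map_on \<mu> (ball 0 1) \<and> \<mu> ` ball 0 1 \<subseteq> ball 0 1 \<and> \<mu> 0 = 0"

definition zero_of_order :: "nat \<Rightarrow> ('a::complex_banach \<Rightarrow> 'b::complex_banach) \<Rightarrow> bool" where
  "zero_of_order m \<mu> \<longleftrightarrow>
     (\<forall>j<m. \<forall>ws. length ws = j \<longrightarrow> nth_frechet j \<mu> 0 ws = 0) \<and>
     (\<exists>ws. length ws = m \<and> nth_frechet m \<mu> 0 ws \<noteq> 0)"

definition taylor_poly :: "('a::complex_banach \<Rightarrow> complex) \<Rightarrow> nat \<Rightarrow> 'a \<Rightarrow> complex" where
  "taylor_poly F s z = nth_frechet s F 0 (replicate s z) / fact s"

text \<open>The Taylor expansion at \<open>0\<close>, with constant term \<open>a = F 0\<close>, is stated as part of the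
  hypotheses on \<open>F\<close>; every mapping satisfying the first two conditions has it.\<close>

definition disc_mapping :: "('a::complex_banach \<Rightarrow> complex) \<Rightarrow> bool" where
  "disc_mapping F \<longleftrightarrow>
     holomorphic_map_on F (ball 0 1) \<and> F ` ball 0 1 \<subseteq> cball 0 1 \<and>
     (\<forall>z\<in>ball 0 1. (\<lambda>s. taylor_poly F (Suc s) z) sums (F z - F 0))"

text \<open>The left-hand side of the inequality at \<open>w = \<mu>(z)\<close>, valued in the extended nonnegative
  reals, so that a divergent series has sum \<open>\<infinity>\<close>.\<close>

definition bohr_sum :: "nat \<Rightarrow> ('a::complex_banach \<Rightarrow> complex) \<Rightarrow> 'a \<Rightarrow> ennreal" where
  "bohr_sum N F w = ennreal (cmod (F w)) +
     (\<Sum>k. ennreal (cmod (nth_frechet (k + N) F w (replicate (k + N) w) / fact (k + N))))"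

definition radius_eq :: "nat \<Rightarrow> nat \<Rightarrow> real \<Rightarrow> bool" where
  "radius_eq m N r \<longleftrightarrow>
     2 * r ^ (m * N) - (1 - r ^ m) ^ (N - 1) * (1 + r ^ m) * (1 - 2 * r ^ m) = 0"

definition smallest_positive_root :: "nat \<Rightarrow> nat \<Rightarrow> real \<Rightarrow> bool" where
  "smallest_positive_root m N R \<longleftrightarrow>
     0 < R \<and> radius_eq m N R \<and> (\<forall>r>0. radius_eq m N r \<longrightarrow> R \<le> r)"

end

theory Submission
  imports Defs "HOL-Complex_Analysis.Complex_Analysis"
begin

text \<open>
  Everything happens on complex lines. Let \<open>w = \<mu> z\<close> with norm \<open>\<rho>\<close>, and let \<open>f\<close> be the restriction
  of \<open>F\<close> to the line through \<open>w\<close>, parametrised so that \<open>f(\<rho>) = F(w)\<close>. Then \<open>f\<close> maps the unit disc to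
  its closure and \<open>D\<^sup>kF(w)(w\<^sup>k) = \<rho>\<^sup>k f\<^sup>(\<^sup>k\<^sup>)(\<rho>)\<close>. Ruscheweyh's higher-order form of the Schwarz-Pick
  inequality (\<open>ruscheweyh_inequality\<close>) bounds the \<open>k\<close>-th summand by
  \<open>(1 - b\<^sup>2) / (1 + \<rho>) * (\<rho> / (1 - \<rho>)) ^ k\<close> with \<open>b = \<bar>F w\<bar>\<close>. Summing over \<open>k \<ge> N\<close> and using
  \<open>1 - b\<^sup>2 \<le> 2 * (1 - b)\<close>, the total is at most \<open>1\<close> as soon as \<open>radius_gap N \<rho> \<le> 0\<close>, where
  \<open>radius_gap N\<close> is the left-hand side of the radius equation in the variable \<open>r\<^sup>m\<close>
  (\<open>bohr_sum_le_1\<close>). This function is increasing on \<open>[0, 1/2]\<close> and has a zero \<open>x\<^sub>0\<close> there, so that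
  \<open>R\<close> is the \<open>m\<close>-th root of \<open>x\<^sub>0\<close>. A Schwarz lemma of order \<open>m\<close> gives \<open>\<rho> \<le> \<parallel>z\<parallel>\<^sup>m\<close>
  (\<open>schwarz_mapping_norm_le\<close>), and the inequality follows.

  For sharpness let \<open>\<psi>\<close> be a functional of norm one that attains its norm at a unit vector \<open>x\<close>, and
  take \<open>\<mu>(z) = \<psi>(z)\<^bsup>m-1\<^esup> z\<close> and \<open>F = (a - \<psi>) / (1 - a \<psi>)\<close>. At \<open>\<mu>(r x) = r\<^sup>m x\<close> the sum can be
  computed, and for \<open>r\<close> slightly larger than \<open>R\<close> it exceeds \<open>1\<close> when \<open>a\<close> is close to \<open>1\<close>
  (\<open>bohr_inequality_fails\<close>).

  Both halves need the higher derivatives to exist, since \<^const>\<open>nth_frechet\<close> is defined by a choice.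
  Cauchy estimates on complex lines show that a map with a complex-linear Frechet derivative is Frechet
  differentiable to all orders (\<open>multi_holomorphic_nth_frechet\<close>); its derivatives on the diagonal
  are the derivatives of its restrictions to complex lines (\<open>higher_deriv_along_line\<close>).
  Values in a Banach space are reduced to complex values by norming functionals, which come from a
  Hahn-Banach argument (\<open>norming_functional\<close>).
\<close>

section \<open>Norming functionals\<close>

text \<open>
  Positive homogeneity is required only as an inequality, which is easier to verify for infima;
  used for both \<open>s\<close> and \<open>1 / s\<close> it becomes the equality \<open>sublinear_scale\<close>.
\<close>

definition sublinear :: "('a::real_vector \<Rightarrow> real) \<Rightarrow> bool" where
  "sublinear p \<longleftrightarrow> (\<forall>x y. p (x + y) \<le> p x + p y) \<and> (\<forall>s>0. \<forall>x. p (s *\<^sub>R x) \<le> s * p x)"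

lemma sublinear_scale:
  assumes "sublinear p" "s \<ge> 0"
  shows "p (s *\<^sub>R x) = s * p x"
proof -
  have le: "p (s *\<^sub>R x) \<le> s * p x" if "s > 0" for s x
    using assms(1) that by (auto simp: sublinear_def)
  have "p 0 = 0"
    using le[of 2 0] le[of "1/2" 0] by simp
  moreover have "s * p x \<le> p (s *\<^sub>R x)" if "s > 0"
    using le[of "inverse s" "s *\<^sub>R x"] that by (simp add: field_simps)
  ultimately show ?thesis
    using le[of s x] assms(2) by (cases "s = 0") (auto intro: antisym)
qed

lemma sublinear_zero: "sublinear p \<Longrightarrow> p 0 = 0"
  using sublinear_scale[of p 0 0] by simp

lemma sublinear_add: "sublinear p \<Longrightarrow> p (x + y) \<le> p x + p y"
  by (simp add: sublinear_def)

lemma sublinear_ge: "sublinear p \<Longrightarrow> - p (- x) \<le> p x"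
  using sublinear_add[of p x "- x"] sublinear_zero[of p] by simp

text \<open>
  The largest sublinear functional below \<open>p\<close> whose value at \<open>- y\<close> is at most \<open>- p y\<close>, that is, which
  is linear on the line through \<open>y\<close>.
\<close>

definition slide :: "('a::real_vector \<Rightarrow> real) \<Rightarrow> 'a \<Rightarrow> 'a \<Rightarrow> real" where
  "slide p y x = (INF t\<in>{0..}. p (x + t *\<^sub>R y) - t * p y)"

lemma slide_le:
  assumes "sublinear p" "t \<ge> 0"
  shows "slide p y x \<le> p (x + t *\<^sub>R y) - t * p y"
proof -
  have "- p (- x) \<le> p (x + t *\<^sub>R y) - t * p y" if "t \<ge> 0" for t
    using sublinear_add[OF assms(1), of "x + t *\<^sub>R y" "- x"] sublinear_scale[OF assms(1) that, of y]
    by simp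
  then have "bdd_below ((\<lambda>t. p (x + t *\<^sub>R y) - t * p y) ` {0..})"
    by (intro bdd_belowI2[where m = "- p (- x)"]) auto
  then show ?thesis
    unfolding slide_def using assms(2) by (intro cINF_lower) auto
qed

lemma le_slideI:
  assumes "\<And>t. t \<ge> 0 \<Longrightarrow> c \<le> p (x + t *\<^sub>R y) - t * p y"
  shows "c \<le> slide p y x"
  unfolding slide_def using assms by (intro cINF_greatest) auto

lemma sublinear_slide:
  assumes p: "sublinear p"
  shows "sublinear (slide p y)"
  unfolding sublinear_def
proof (intro conjI allI impI)
  fix x1 x2
  have *: "slide p y (x1 + x2) \<le> (p (x1 + t1 *\<^sub>R y) - t1 * p y) + (p (x2 + t2 *\<^sub>R y) - t2 * p y)"
    if "t1 \<ge> 0" "t2 \<ge> 0" for t1 t2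
    using slide_le[OF p, of "t1 + t2" y "x1 + x2"] that
      sublinear_add[OF p, of "x1 + t1 *\<^sub>R y" "x2 + t2 *\<^sub>R y"]
    by (simp add: algebra_simps)
  have "slide p y (x1 + x2) - (p (x1 + t1 *\<^sub>R y) - t1 * p y) \<le> slide p y x2" if "t1 \<ge> 0" for t1
    using *[OF that] by (intro le_slideI) (auto simp: algebra_simps)
  then have "slide p y (x1 + x2) - slide p y x2 \<le> slide p y x1"
    by (intro le_slideI) (auto simp: algebra_simps)
  then show "slide p y (x1 + x2) \<le> slide p y x1 + slide p y x2"
    by simp
next
  fix s :: real and x
  assume s: "s > 0"
  have "inverse s * slide p y (s *\<^sub>R x) \<le> slide p y x"
  proof (rule le_slideI)
    fix t :: real assume t: "t \<ge> 0"
    have "slide p y (s *\<^sub>R x) \<le> p (s *\<^sub>R x + (s * t) *\<^sub>R y) - (s * t) * p y"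
      using s t by (intro slide_le[OF p]) auto
    also have "\<dots> = s * (p (x + t *\<^sub>R y) - t * p y)"
      using sublinear_scale[OF p, of s "x + t *\<^sub>R y"] s by (simp add: algebra_simps)
    finally show "inverse s * slide p y (s *\<^sub>R x) \<le> p (x + t *\<^sub>R y) - t * p y"
      using s by (simp add: field_simps)
  qed
  then show "slide p y (s *\<^sub>R x) \<le> s * slide p y x"
    using s by (simp add: field_simps)
qed

lemma slide_le_self: "sublinear p \<Longrightarrow> slide p y \<le> p"
  using slide_le[of p 0 y] by (auto simp: le_fun_def)

text \<open>
  Zorn's lemma: the pointwise infimum of a chain is again sublinear, and it is finite because every
  sublinear functional below \<open>q\<close> is bounded below by \<open>- q (- x)\<close> at \<open>x\<close>.
\<close>

lemma minimal_sublinear_below: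
  assumes q: "sublinear q"
  obtains p where "sublinear p" "p \<le> q" "\<And>p'. sublinear p' \<Longrightarrow> p' \<le> p \<Longrightarrow> p' = p"
proof -
  define A where "A = {p. sublinear p \<and> p \<le> q}"
  have "\<exists>m\<in>A. \<forall>a\<in>A. a \<le> m \<longrightarrow> a = m"
  proof (rule predicate_Zorn)
    show "partial_order_on A (relation_of (\<lambda>p p'. p' \<le> p) A)"
      by (auto intro: partial_order_on_relation_ofI order.trans)
  next
    fix C assume C: "C \<in> Chains (relation_of (\<lambda>p p'. p' \<le> p) A)"
    then have CA: "C \<subseteq> A"
      by (auto simp: Chains_def relation_of_def)
    have chain: "p \<le> p' \<or> p' \<le> p" if "p \<in> C" "p' \<in> C" for p p'
      using C that by (auto simp: Chains_def relation_of_def)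
    show "\<exists>u\<in>A. \<forall>a\<in>C. u \<le> a"
    proof (cases "C = {}")
      case True
      then show ?thesis using q by (auto simp: A_def)
    next
      case False
      define u where "u x = (INF p\<in>C. p x)" for x
      have C_D: "sublinear p" "p x \<le> q x" if "p \<in> C" for p x
        using CA that by (auto simp: A_def le_fun_def)
      have lower: "u x \<le> p x" if "p \<in> C" for p x
      proof -
        have "- q (- x) \<le> p x" if "p \<in> C" for p
          using sublinear_ge[OF C_D(1)[OF that], of x] C_D(2)[OF that, of "- x"] by simp
        then have "bdd_below ((\<lambda>p. p x) ` C)"
          by (intro bdd_belowI2[where m = "- q (- x)"])
        then show ?thesis unfolding u_def using that by (intro cINF_lower)
      qed
      have greatest: "c \<le> u x" if "\<And>p. p \<in> C \<Longrightarrow> c \<le> p x" for c x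
        unfolding u_def using False that by (intro cINF_greatest)
      have "sublinear u"
        unfolding sublinear_def
      proof (intro conjI allI impI)
        fix x y
        have *: "u (x + y) \<le> p x + p' y" if pp: "p \<in> C" "p' \<in> C" for p p'
        proof -
          obtain p'' where "p'' \<in> C" "p'' \<le> p" "p'' \<le> p'"
            using chain[OF pp] pp by blast
          then show ?thesis
            using lower[of p'' "x + y"] sublinear_add[OF C_D(1), of p'' x y]
            by (smt (verit, best) le_fun_def)
        qed
        have "u (x + y) - p x \<le> u y" if "p \<in> C" for p
          using *[OF that] by (intro greatest) (auto simp: algebra_simps)
        then have "u (x + y) - u y \<le> u x"
          by (intro greatest) (auto simp: algebra_simps)
        then show "u (x + y) \<le> u x + u y" by simp
      next
        fix s :: real and x assume s: "s > 0"
        have "inverse s * u (s *\<^sub>R x) \<le> u x"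
        proof (rule greatest)
          fix p assume p: "p \<in> C"
          have "u (s *\<^sub>R x) \<le> s * p x"
            using lower[OF p, of "s *\<^sub>R x"] sublinear_scale[OF C_D(1)[OF p], of s x] s by simp
          then show "inverse s * u (s *\<^sub>R x) \<le> p x"
            using s by (simp add: field_simps)
        qed
        then show "u (s *\<^sub>R x) \<le> s * u x"
          using s by (simp add: field_simps)
      qed
      moreover have "u \<le> q"
      proof -
        obtain p where "p \<in> C" using False by blast
        then show ?thesis
          using lower[of p] C_D(2)[of p] by (metis le_funI order.trans)
      qed
      ultimately show ?thesis
        using lower by (auto simp: A_def le_fun_def)
    qed
  qed
  then show ?thesis
    using that unfolding A_def by (metis (mono_tags, lifting) mem_Collect_eq order.trans)
qed

text \<open>
  Minimality forces \<open>slide p y = p\<close> for every \<open>y\<close>, and the value \<open>t = 1\<close> in the infimum then gives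
  superadditivity of \<open>p\<close>.
\<close>

lemma minimal_sublinear_linear:
  assumes p: "sublinear p" and min: "\<And>p'. sublinear p' \<Longrightarrow> p' \<le> p \<Longrightarrow> p' = p"
  shows "linear p"
proof -
  have add: "p (x + y) = p x + p y" for x y
  proof -
    have "p x = slide p y x"
      using min[OF sublinear_slide[OF p] slide_le_self[OF p]] by metis
    also have "\<dots> \<le> p (x + y) - p y"
      using slide_le[OF p, of 1 y x] by simp
    finally show ?thesis
      using sublinear_add[OF p, of x y] by simp
  qed
  have minus: "p (- x) = - p x" for x
    using add[of x "- x"] sublinear_zero[OF p] by simp
  have "p (s *\<^sub>R x) = s * p x" for s x
    using sublinear_scale[OF p, of s x] sublinear_scale[OF p, of "- s" x] minus[of "s *\<^sub>R x"]
    by (cases "s \<ge> 0") auto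
  then show ?thesis
    using add by (intro linearI) auto
qed

text \<open>
  Descending from \<open>slide norm x0\<close> instead of the norm itself forces \<open>u (- x0) \<le> - norm x0\<close>.
\<close>

lemma norming_functional_real:
  fixes x0 :: "'a::real_normed_vector"
  obtains u where "linear u" "\<And>x. u x \<le> norm x" "u x0 = norm x0"
proof -
  have norm: "sublinear (norm :: 'a \<Rightarrow> real)"
    by (auto simp: sublinear_def norm_triangle_ineq)
  obtain u where u: "sublinear u" "u \<le> slide norm x0"
    and min: "\<And>p. sublinear p \<Longrightarrow> p \<le> u \<Longrightarrow> p = u"
    using minimal_sublinear_below[OF sublinear_slide[OF norm, of x0]] by metis
  have lin: "linear u"
    using minimal_sublinear_linear[OF u(1) min] .
  have le: "u x \<le> norm x" for x
    using u(2) slide_le_self[OF norm, of x0] by (metis le_funE order.trans)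
  have "u (- x0) \<le> slide norm x0 (- x0)"
    using u(2) by (simp add: le_fun_def)
  also have "\<dots> \<le> - norm x0"
    using slide_le[OF norm, of 1 x0 "- x0"] by simp
  finally have "norm x0 \<le> u x0"
    using lin by (simp add: linear_neg)
  with le[of x0] have "u x0 = norm x0" by simp
  with lin le show ?thesis by (rule that)
qed

definition contractive_functional :: "('a::complex_normed_vector \<Rightarrow> complex) \<Rightarrow> bool" where
  "contractive_functional \<psi> \<longleftrightarrow> (\<forall>x y. \<psi> (x + y) = \<psi> x + \<psi> y) \<and>
     (\<forall>c x. \<psi> (c *\<^sub>C x) = c * \<psi> x) \<and> (\<forall>x. cmod (\<psi> x) \<le> norm x)"

text \<open>
  The complex functional is \<open>u x - \<i> u (\<i> x)\<close>. Its modulus at \<open>x\<close> is the real part of its value at a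
  rotated vector, hence is bounded like \<open>u\<close>.
\<close>

lemma norming_functional:
  fixes x0 :: "'a::complex_normed_vector"
  obtains \<psi> where "contractive_functional \<psi>" "\<psi> x0 = of_real (norm x0)"
proof -
  obtain u where lin: "linear u" and le: "\<And>x :: 'a. u x \<le> norm x" and x0: "u x0 = norm x0"
    using norming_functional_real by blast
  define \<psi> where "\<psi> x = Complex (u x) (- u (\<i> *\<^sub>C x))" for x
  have add: "\<psi> (x + y) = \<psi> x + \<psi> y" for x y
    using lin by (simp add: \<psi>_def scaleC_add_right linear_add complex_eq_iff)
  have scale: "\<psi> (c *\<^sub>C x) = c * \<psi> x" for c x
  proof -
    have 1: "\<psi> (of_real r *\<^sub>C x) = of_real r * \<psi> x" for r x
    proof -
      have "\<i> *\<^sub>C complex_of_real r *\<^sub>C x = complex_of_real r *\<^sub>C \<i> *\<^sub>C x"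
        by (simp add: scaleC_scaleC mult.commute)
      then show ?thesis
        using lin by (simp add: \<psi>_def scaleC_of_real linear_scale complex_eq_iff)
    qed
    have 2: "\<psi> (\<i> *\<^sub>C x) = \<i> * \<psi> x" for x
    proof -
      have "\<i> *\<^sub>C \<i> *\<^sub>C x = complex_of_real (-1) *\<^sub>C x"
        by (simp add: scaleC_scaleC)
      also have "\<dots> = - x"
        by (simp only: scaleC_of_real) simp
      finally show ?thesis
        using lin by (simp add: \<psi>_def linear_neg complex_eq_iff)
    qed
    have "c *\<^sub>C x = of_real (Re c) *\<^sub>C x + \<i> *\<^sub>C of_real (Im c) *\<^sub>C x"
      using complex_eq[of c] by (simp add: scaleC_scaleC scaleC_add_left[symmetric])
    then have "\<psi> (c *\<^sub>C x) = of_real (Re c) * \<psi> x + \<i> * (of_real (Im c) * \<psi> x)"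
      by (simp add: add 1 2)
    also have "\<dots> = c * \<psi> x"
      by (subst (3) complex_eq) (simp add: algebra_simps)
    finally show ?thesis .
  qed
  have bound: "cmod (\<psi> x) \<le> norm x" for x
  proof (cases "\<psi> x = 0")
    case False
    define c where "c = cnj (\<psi> x) / cmod (\<psi> x)"
    have c: "cmod c = 1" using False by (simp add: c_def norm_divide)
    have "\<psi> (c *\<^sub>C x) = cnj (\<psi> x) * \<psi> x / cmod (\<psi> x)"
      by (simp add: scale c_def)
    also have "\<dots> = of_real (cmod (\<psi> x))"
      using False by (simp add: complex_norm_square[symmetric] mult.commute power2_eq_square)
    finally have "cmod (\<psi> x) = Re (\<psi> (c *\<^sub>C x))" by simp
    also have "\<dots> \<le> norm (c *\<^sub>C x)"
      by (simp add: \<psi>_def le)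
    finally show ?thesis by (simp add: norm_scaleC c)
  qed simp
  have "Re (\<psi> x0) = norm x0"
    by (simp add: \<psi>_def x0)
  moreover from this have "Im (\<psi> x0) = 0"
    using bound[of x0] power_mono[of "cmod (\<psi> x0)" "norm x0" 2] cmod_power2[of "\<psi> x0"] by simp
  ultimately have "\<psi> x0 = of_real (norm x0)"
    by (simp add: complex_eq_iff)
  then show ?thesis
    using that[of \<psi>] add scale bound by (auto simp: contractive_functional_def)
qed

section \<open>Holomorphic maps along complex lines\<close>

definition frechet_D :: "('a::complex_banach \<Rightarrow> 'b::complex_banach) \<Rightarrow> 'a \<Rightarrow> 'a \<Rightarrow> 'b" where
  "frechet_D g z = frechet_derivative g (at z)"

lemma holomorphic_map_on_subset:
  "holomorphic_map_on g U \<Longrightarrow> V \<subseteq> U \<Longrightarrow> holomorphic_map_on g V"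
  by (auto simp: holomorphic_map_on_def)

lemma holomorphic_map_onI:
  assumes "\<And>z. z \<in> U \<Longrightarrow> (g has_derivative L z) (at z)"
    and "\<And>z c x. z \<in> U \<Longrightarrow> L z (c *\<^sub>C x) = c *\<^sub>C L z x"
  shows "holomorphic_map_on g U"
  using assms unfolding holomorphic_map_on_def by blast

lemma frechet_D_eqI: "(g has_derivative L) (at z) \<Longrightarrow> frechet_D g z = L"
  unfolding frechet_D_def by (rule frechet_derivative_at[symmetric])

lemma holomorphic_map_has_derivative:
  assumes "holomorphic_map_on g U" "z \<in> U"
  shows "(g has_derivative frechet_D g z) (at z)"
proof -
  obtain L where "(g has_derivative L) (at z)"
    using assms by (auto simp: holomorphic_map_on_def)
  then show ?thesis using frechet_D_eqI by blast
qed

lemma frechet_D_scaleC: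
  assumes "holomorphic_map_on g U" "z \<in> U"
  shows "frechet_D g z (c *\<^sub>C x) = c *\<^sub>C frechet_D g z x"
proof -
  obtain L where "(g has_derivative L) (at z)" "\<And>c x. L (c *\<^sub>C x) = c *\<^sub>C L x"
    using assms by (auto simp: holomorphic_map_on_def)
  then show ?thesis using frechet_D_eqI by metis
qed

lemma linear_frechet_D:
  assumes "holomorphic_map_on g U" "z \<in> U"
  shows "linear (frechet_D g z)"
  using holomorphic_map_has_derivative[OF assms] by (rule has_derivative_linear)

lemma frechet_D_add_direction:
  assumes "holomorphic_map_on g U" "z \<in> U"
  shows "frechet_D g z (x + y) = frechet_D g z x + frechet_D g z y"
  using linear_frechet_D[OF assms] by (rule linear_add)

lemma contractive_functional_simps:
  assumes "contractive_functional \<psi>"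
  shows "\<psi> (x + y) = \<psi> x + \<psi> y" "\<psi> (c *\<^sub>C x) = c * \<psi> x" "cmod (\<psi> x) \<le> norm x"
    "\<psi> (r *\<^sub>R x) = r *\<^sub>R \<psi> x" "\<psi> 0 = 0" "\<psi> (x - y) = \<psi> x - \<psi> y"
proof -
  have 1: "\<psi> (x + y) = \<psi> x + \<psi> y" "\<psi> (c *\<^sub>C x) = c * \<psi> x" for c x y
    using assms by (auto simp: contractive_functional_def)
  show "cmod (\<psi> x) \<le> norm x" using assms by (auto simp: contractive_functional_def)
  show r: "\<psi> (r *\<^sub>R x) = r *\<^sub>R \<psi> x" for r x
    using 1(2)[of "of_real r" x] by (simp add: scaleC_of_real scaleR_conv_of_real)
  show "\<psi> 0 = 0" using 1(1)[of 0 0] by simp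
  show "\<psi> (x - y) = \<psi> x - \<psi> y"
    using 1(1)[of x "(-1) *\<^sub>R y"] r[of "-1" y] by simp
qed (use assms in \<open>auto simp: contractive_functional_def\<close>)

lemma bounded_linear_contractive:
  assumes "contractive_functional \<psi>"
  shows "bounded_linear \<psi>"
  by (rule bounded_linear_intro[of _ 1])
    (auto simp: contractive_functional_simps[OF assms])

lemma scaleC_scaleR_commute: "c *\<^sub>C r *\<^sub>R (x::'a::complex_normed_vector) = r *\<^sub>R c *\<^sub>C x"
  by (simp add: scaleC_of_real[symmetric] scaleC_scaleC mult.commute)

lemma bounded_bilinear_scaleC:
  "bounded_bilinear (\<lambda>c (x::'a::complex_normed_vector). c *\<^sub>C x)"
proof
  show "\<exists>K. \<forall>c (x::'a). norm (c *\<^sub>C x) \<le> norm c * norm x * K"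
    by (intro exI[of _ 1]) (simp add: norm_scaleC)
  fix r :: real and c :: complex and x :: 'a
  show "(r *\<^sub>R c) *\<^sub>C x = r *\<^sub>R c *\<^sub>C x"
    by (simp add: scaleC_of_real[of r "c *\<^sub>C x", symmetric] scaleC_scaleC scaleR_conv_of_real)
qed (simp_all add: scaleC_add_left scaleC_add_right scaleC_scaleR_commute)

lemmas bounded_linear_scaleC_left = bounded_bilinear.bounded_linear_left[OF bounded_bilinear_scaleC]
lemmas bounded_linear_scaleC_right = bounded_bilinear.bounded_linear_right[OF bounded_bilinear_scaleC]
lemmas scaleC_zero_left [simp] = bounded_bilinear.zero_left[OF bounded_bilinear_scaleC]
lemmas scaleC_diff_right = bounded_bilinear.diff_right[OF bounded_bilinear_scaleC]

text \<open>
  Composing with a functional on one side and with a complex line on the other side turns a map between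
  Banach spaces into a function of one complex variable; all estimates below are obtained in this way.
\<close>

lemma has_field_derivative_along_line:
  assumes g: "holomorphic_map_on g U" and \<psi>: "contractive_functional \<psi>" and t: "z + t *\<^sub>C x \<in> U"
  shows "((\<lambda>s. \<psi> (g (z + s *\<^sub>C x))) has_field_derivative \<psi> (frechet_D g (z + t *\<^sub>C x) x)) (at t)"
proof -
  have "((\<lambda>s. z + s *\<^sub>C x) has_derivative (\<lambda>s. s *\<^sub>C x)) (at t)"
    using bounded_linear_imp_has_derivative[OF bounded_linear_scaleC_left]
    by (auto intro!: derivative_eq_intros)
  from has_derivative_compose[OF this holomorphic_map_has_derivative[OF g t]]
  have "((\<lambda>s. g (z + s *\<^sub>C x)) has_derivative (\<lambda>s. s *\<^sub>C frechet_D g (z + t *\<^sub>C x) x)) (at t)"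
    by (simp add: frechet_D_scaleC[OF g t])
  from bounded_linear.has_derivative[OF bounded_linear_contractive[OF \<psi>] this]
  show ?thesis
    by (simp add: has_field_derivative_def contractive_functional_simps[OF \<psi>] mult_commute_abs)
qed

lemma holomorphic_on_along_line:
  assumes "holomorphic_map_on g U" "contractive_functional \<psi>" "\<And>t. t \<in> S \<Longrightarrow> z + t *\<^sub>C x \<in> U"
  shows "(\<lambda>s. \<psi> (g (z + s *\<^sub>C x))) holomorphic_on S"
proof (rule holomorphic_onI)
  fix t assume "t \<in> S"
  from has_field_derivative_along_line[OF assms(1,2) assms(3)[OF this]]
  show "(\<lambda>s. \<psi> (g (z + s *\<^sub>C x))) field_differentiable (at t within S)"
    using field_differentiable_at_within field_differentiable_def by blast
qed

text \<open>
  The radius \<open>r\<close> is smaller than that of the domain because \<open>\<phi>\<close> need not extend continuously to the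
  boundary.
\<close>

lemma cauchy_estimate_disc:
  assumes hol: "\<phi> holomorphic_on ball a s" and r: "0 < r" "r < s"
    and bound: "\<And>t. t \<in> ball a s \<Longrightarrow> cmod (\<phi> t) \<le> M"
  shows "cmod ((deriv ^^ n) \<phi> a) \<le> fact n * M / r ^ n"
proof (rule Cauchy_inequality)
  show "\<phi> holomorphic_on ball a r"
    using hol r by (auto elim: holomorphic_on_subset)
  show "continuous_on (cball a r) \<phi>"
    using holomorphic_on_imp_continuous_on[OF hol] r by (auto elim: continuous_on_subset)
  show "cmod (\<phi> t) \<le> M" if "cmod (a - t) = r" for t
    using that r by (intro bound) (auto simp: dist_norm)
qed fact

text \<open>
  About each point of the closed unit disc there is a disc of radius \<open>s / 2\<close> inside the domain, so
  Cauchy's estimate bounds \<open>\<phi>''\<close> on the closed unit disc by a multiple of \<open>M / s\<^sup>2\<close>.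
\<close>

lemma taylor_remainder_disc:
  assumes hol: "\<phi> holomorphic_on ball 0 s" and s: "s \<ge> 2"
    and bound: "\<And>t. t \<in> ball 0 s \<Longrightarrow> cmod (\<phi> t) \<le> M"
  shows "cmod (\<phi> 1 - \<phi> 0 - deriv \<phi> 0) \<le> 32 * M / s ^ 2"
proof -
  have sub: "ball t (s/2) \<subseteq> ball 0 s" if "t \<in> cball 0 1" for t :: complex
  proof
    fix u assume "u \<in> ball t (s/2)"
    then show "u \<in> ball 0 s"
      using norm_triangle_ineq[of "u - t" t] that s by (auto simp: dist_norm norm_minus_commute)
  qed
  have "cmod ((deriv ^^ 2) \<phi> t) \<le> fact 2 * M / (s/4) ^ 2" if "t \<in> cball 0 1" for t
    by (rule cauchy_estimate_disc[where s = "s/2"])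
      (use sub[OF that] hol bound s in \<open>auto elim: holomorphic_on_subset\<close>)
  then have d2: "cmod ((deriv ^^ Suc 1) \<phi> t) \<le> 32 * M / s ^ 2" if "t \<in> cball 0 1" for t
    using that by (simp add: power_divide numeral_2_eq_2)
  have "cmod ((deriv ^^ 0) \<phi> 1 - (\<Sum>i\<le>1. (deriv ^^ i) \<phi> 0 * (1 - 0) ^ i / fact i))
      \<le> 32 * M / s ^ 2 * cmod (1 - 0) ^ Suc 1 / fact 1"
  proof (rule complex_Taylor[where S = "cball 0 1"])
    fix i :: nat and x :: complex assume "x \<in> cball 0 1"
    then have "((deriv ^^ i) \<phi>) field_differentiable at x"
      using holomorphic_higher_deriv[OF hol, of i] s
      by (auto simp: holomorphic_on_open field_differentiable_def)
    then show "((deriv ^^ i) \<phi> has_field_derivative (deriv ^^ Suc i) \<phi> x) (at x within cball 0 1)"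
      by (simp add: field_differentiable_derivI has_field_derivative_at_within)
  qed (use d2 in auto)
  then show ?thesis by (simp add: diff_diff_eq)
qed

text \<open>
  On the line through \<open>z\<close> in direction \<open>h\<close> the map is defined on a disc of radius \<open>\<delta> / norm h\<close>. The
  factor \<open>2\<close> is lost by applying Cauchy's estimate on half of this disc.
\<close>

lemma cauchy_estimate_map:
  assumes hol: "holomorphic_map_on g (ball z \<delta>)" and \<delta>: "\<delta> > 0"
    and bound: "\<And>y. y \<in> ball z \<delta> \<Longrightarrow> norm (g y) \<le> M"
  shows "norm (frechet_D g z h) \<le> 2 * M / \<delta> * norm h"
proof (cases "h = 0")
  case True
  then show ?thesis
    using linear_0[OF linear_frechet_D[OF hol]] \<delta> by simp
next
  case False
  obtain \<psi> where \<psi>: "contractive_functional \<psi>"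
    and eq: "\<psi> (frechet_D g z h) = of_real (norm (frechet_D g z h))"
    by (rule norming_functional)
  define s where "s = \<delta> / norm h"
  have s: "s > 0" using False \<delta> by (simp add: s_def)
  define \<phi> where "\<phi> t = \<psi> (g (z + t *\<^sub>C h))" for t
  have in_ball: "z + t *\<^sub>C h \<in> ball z \<delta>" if "t \<in> ball 0 s" for t
    using that False by (simp add: dist_norm norm_scaleC s_def field_simps)
  have "\<phi> holomorphic_on ball 0 s"
    unfolding \<phi>_def using in_ball by (rule holomorphic_on_along_line[OF hol \<psi>])
  moreover have "cmod (\<phi> t) \<le> M" if "t \<in> ball 0 s" for t
    using contractive_functional_simps(3)[OF \<psi>] bound[OF in_ball[OF that]]
    unfolding \<phi>_def by (rule order.trans)
  ultimately have "cmod ((deriv ^^ 1) \<phi> 0) \<le> fact 1 * M / (s / 2) ^ 1"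
    using s by (intro cauchy_estimate_disc[where s = s]) auto
  moreover have "deriv \<phi> 0 = \<psi> (frechet_D g z h)"
    using has_field_derivative_along_line[OF hol \<psi>, of z 0 h] \<delta>
    by (auto simp: \<phi>_def[abs_def] intro!: DERIV_imp_deriv)
  ultimately show ?thesis
    using False \<delta> by (simp add: eq s_def field_simps)
qed

text \<open>
  The constant depends on \<open>g\<close> only through the bound \<open>M\<close>. This uniformity is what later gives
  convergence of difference quotients in the norm of multilinear maps.
\<close>

lemma taylor_remainder_map:
  assumes hol: "holomorphic_map_on g (ball z \<delta>)" and \<delta>: "\<delta> > 0"
    and bound: "\<And>y. y \<in> ball z \<delta> \<Longrightarrow> norm (g y) \<le> M" and h: "norm h \<le> \<delta> / 2"
  shows "norm (g (z + h) - g z - frechet_D g z h) \<le> 32 * M / \<delta> ^ 2 * norm h ^ 2"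
proof (cases "h = 0")
  case True
  then show ?thesis
    using linear_0[OF linear_frechet_D[OF hol]] \<delta> by simp
next
  case False
  obtain \<psi> where \<psi>: "contractive_functional \<psi>"
    and eq: "\<psi> (g (z + h) - g z - frechet_D g z h) = of_real (norm (g (z + h) - g z - frechet_D g z h))"
    by (rule norming_functional)
  define s where "s = \<delta> / norm h"
  have s: "s \<ge> 2" using False h by (simp add: s_def field_simps)
  define \<phi> where "\<phi> t = \<psi> (g (z + t *\<^sub>C h))" for t
  have in_ball: "z + t *\<^sub>C h \<in> ball z \<delta>" if "t \<in> ball 0 s" for t
    using that False by (simp add: dist_norm norm_scaleC s_def field_simps)
  have "\<phi> holomorphic_on ball 0 s"
    unfolding \<phi>_def using in_ball by (rule holomorphic_on_along_line[OF hol \<psi>])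
  moreover have "cmod (\<phi> t) \<le> M" if "t \<in> ball 0 s" for t
    using contractive_functional_simps(3)[OF \<psi>] bound[OF in_ball[OF that]]
    unfolding \<phi>_def by (rule order.trans)
  ultimately have "cmod (\<phi> 1 - \<phi> 0 - deriv \<phi> 0) \<le> 32 * M / s ^ 2"
    using s by (intro taylor_remainder_disc)
  moreover have "deriv \<phi> 0 = \<psi> (frechet_D g z h)"
    using has_field_derivative_along_line[OF hol \<psi>, of z 0 h] \<delta>
    by (auto simp: \<phi>_def[abs_def] intro!: DERIV_imp_deriv)
  ultimately have "cmod (\<psi> (g (z + h) - g z - frechet_D g z h)) \<le> 32 * M / s ^ 2"
    by (simp add: \<phi>_def scaleC_one contractive_functional_simps(6)[OF \<psi>])
  then have "norm (g (z + h) - g z - frechet_D g z h) \<le> 32 * M / s ^ 2"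
    by (simp only: eq norm_of_real abs_norm_cancel)
  then show ?thesis
    using False \<delta> by (simp add: s_def power_divide)
qed

lemma holomorphic_map_locally_bounded:
  assumes "holomorphic_map_on g U" "open U" "z \<in> U"
  obtains \<delta> M where "\<delta> > 0" "M \<ge> 0" "ball z \<delta> \<subseteq> U" "\<And>y. y \<in> ball z \<delta> \<Longrightarrow> norm (g y) \<le> M"
proof -
  have "isCont g z"
    using holomorphic_map_has_derivative[OF assms(1,3)] by (rule has_derivative_continuous)
  then obtain d where d: "d > 0" "\<And>y. dist y z < d \<Longrightarrow> dist (g y) (g z) < 1"
    by (metis continuous_at_eps_delta zero_less_one)
  obtain e where e: "e > 0" "ball z e \<subseteq> U"
    using assms by (auto simp: open_contains_ball)
  show ?thesis
  proof (rule that[of "min d e" "norm (g z) + 1"])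
    fix y assume "y \<in> ball z (min d e)"
    then show "norm (g y) \<le> norm (g z) + 1"
      using d(2)[of y] norm_triangle_ineq2[of "g y" "g z"] by (auto simp: dist_norm norm_minus_commute)
  qed (use d e in auto)
qed

text \<open>
  The difference quotients of \<open>g\<close> in direction \<open>h\<close> are holomorphic and converge uniformly on a ball, by
  \<open>taylor_remainder_map\<close>. Cauchy's estimate makes their derivatives uniformly Cauchy on a smaller ball,
  so the limit is differentiable, and its derivative is complex-linear as a limit of complex-linear maps.
\<close>

lemma holomorphic_map_frechet_D:
  fixes g :: "'a::complex_banach \<Rightarrow> 'b::complex_banach"
  assumes hol: "holomorphic_map_on g U" and "open U"
  shows "holomorphic_map_on (\<lambda>z. frechet_D g z h) U"
  unfolding holomorphic_map_on_def
proof
  fix z0 assume "z0 \<in> U"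
  then obtain \<delta>' M where \<delta>': "\<delta>' > 0" "M \<ge> 0" "ball z0 \<delta>' \<subseteq> U"
    and bound: "\<And>y. y \<in> ball z0 \<delta>' \<Longrightarrow> norm (g y) \<le> M"
    using holomorphic_map_locally_bounded[OF hol \<open>open U\<close>] by metis
  \<comment> \<open>radii: derivatives of difference quotients are compared on radius \<open>\<delta>\<close>, the quotients themselves on \<open>2 * \<delta>\<close>, and \<open>g\<close> is bounded on \<open>4 * \<delta>\<close>\<close>
  define \<delta> where "\<delta> = \<delta>' / 4"
  have \<delta>: "\<delta> > 0" "\<delta>' = 4 * \<delta>" using \<delta>' by (auto simp: \<delta>_def)
  obtain k where k: "norm h < real k * \<delta>"
    using ex_less_of_nat_mult[OF \<delta>(1)] by blast
  \<comment> \<open>the shift by \<open>k\<close> makes already the first increment at most \<open>\<delta>\<close>\<close>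
  define e where "e n = 1 / real (Suc (n + k))" for n
  have e: "e n > 0" "norm (e n *\<^sub>R h) \<le> \<delta>" for n
  proof -
    show "e n > 0" by (simp add: e_def)
    have "real k * \<delta> \<le> real (Suc (n + k)) * \<delta>"
      using \<delta> by (intro mult_right_mono) auto
    then show "norm (e n *\<^sub>R h) \<le> \<delta>"
      using k by (simp add: e_def field_simps)
  qed
  define f where "f n y = (1 / e n) *\<^sub>R (g (y + e n *\<^sub>R h) - g y)" for n y
  define f' where "f' n y v = (1 / e n) *\<^sub>R (frechet_D g (y + e n *\<^sub>R h) v - frechet_D g y v)" for n y v
  have in_U: "y \<in> U" "y + e n *\<^sub>R h \<in> U" if "y \<in> ball z0 (2 * \<delta>)" for y n
  proof -
    have "norm (z0 - (y + e n *\<^sub>R h)) \<le> norm (z0 - y) + norm (e n *\<^sub>R h)"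
      by (metis diff_diff_eq norm_triangle_ineq4)
    then have "y + e n *\<^sub>R h \<in> ball z0 \<delta>'"
      using that e(2)[of n] \<delta> by (auto simp: dist_norm)
    then show "y + e n *\<^sub>R h \<in> U" using \<delta>' by blast
    have "y \<in> ball z0 \<delta>'" using that \<delta> by auto
    then show "y \<in> U" using \<delta>' by blast
  qed
  have f_deriv: "(f n has_derivative f' n y) (at y)" if "y \<in> ball z0 (2 * \<delta>)" for n y
  proof -
    have "((\<lambda>y. y + e n *\<^sub>R h) has_derivative (\<lambda>v. v)) (at y)"
      by (auto intro!: derivative_eq_intros)
    from has_derivative_compose[OF this, of g "frechet_D g (y + e n *\<^sub>R h)"]
    have "((\<lambda>y. g (y + e n *\<^sub>R h)) has_derivative frechet_D g (y + e n *\<^sub>R h)) (at y)"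
      using holomorphic_map_has_derivative[OF hol in_U(2)[OF that]] by simp
    from has_derivative_scaleR_right[OF has_derivative_diff[OF this
          holomorphic_map_has_derivative[OF hol in_U(1)[OF that]]], of "1 / e n"]
    show ?thesis by (simp add: f_def[abs_def] f'_def[abs_def])
  qed
  have f'_scaleC: "f' n y (c *\<^sub>C v) = c *\<^sub>C f' n y v" if "y \<in> ball z0 (2 * \<delta>)" for n y c v
    unfolding f'_def frechet_D_scaleC[OF hol in_U(1)[OF that]] frechet_D_scaleC[OF hol in_U(2)[OF that]]
    by (simp add: scaleC_scaleR_commute scaleC_diff_right)
  define K where "K = 32 * M / (2 * \<delta>) ^ 2 * norm h ^ 2"
  have f_approx: "norm (f n y - frechet_D g y h) \<le> K * e n" if y: "y \<in> ball z0 (2 * \<delta>)" for n y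
  proof -
    have sub: "ball y (2 * \<delta>) \<subseteq> ball z0 \<delta>'"
    proof
      fix x assume "x \<in> ball y (2 * \<delta>)"
      then show "x \<in> ball z0 \<delta>'"
        using y dist_triangle[of z0 x y] \<delta> by auto
    qed
    have "norm (g (y + e n *\<^sub>R h) - g y - frechet_D g y (e n *\<^sub>R h))
        \<le> 32 * M / (2 * \<delta>) ^ 2 * norm (e n *\<^sub>R h) ^ 2"
    proof (rule taylor_remainder_map)
      show "holomorphic_map_on g (ball y (2 * \<delta>))"
        using hol sub \<delta>'(3) by (blast intro: holomorphic_map_on_subset)
    qed (use bound sub e(2)[of n] \<delta> in auto)
    also have "\<dots> = K * e n ^ 2"
      using e(1)[of n] by (simp add: K_def power_mult_distrib)
    finally have "norm (e n *\<^sub>R (f n y - frechet_D g y h)) \<le> K * e n ^ 2"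
      using e(1)[of n] linear_scale[OF linear_frechet_D[OF hol in_U(1)[OF y]], of "e n" h]
      by (simp add: f_def scaleR_diff_right)
    then have "e n * norm (f n y - frechet_D g y h) \<le> e n * (K * e n)"
      using e(1)[of n] by (simp add: power2_eq_square mult_ac)
    then show ?thesis
      using e(1)[of n] by simp
  qed
  have f'_cauchy: "norm (f' n y v - f' l y v) \<le> 2 * (K * e n + K * e l) / \<delta> * norm v"
    if y: "y \<in> ball z0 \<delta>" for n l y v
  proof -
    have sub: "ball y \<delta> \<subseteq> ball z0 (2 * \<delta>)"
    proof
      fix x assume "x \<in> ball y \<delta>"
      then show "x \<in> ball z0 (2 * \<delta>)"
        using y dist_triangle[of z0 x y] by auto
    qed
    have der: "((\<lambda>x. f n x - f l x) has_derivative (\<lambda>v. f' n x v - f' l x v)) (at x)"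
      if "x \<in> ball y \<delta>" for x
      using that sub by (intro has_derivative_diff f_deriv) auto
    have "norm (frechet_D (\<lambda>x. f n x - f l x) y v) \<le> 2 * (K * e n + K * e l) / \<delta> * norm v"
    proof (rule cauchy_estimate_map)
      show "holomorphic_map_on (\<lambda>x. f n x - f l x) (ball y \<delta>)"
        using sub by (intro holomorphic_map_onI[OF der]) (auto simp: f'_scaleC scaleC_diff_right)
    next
      fix x assume "x \<in> ball y \<delta>"
      with sub have x: "x \<in> ball z0 (2 * \<delta>)" by blast
      have "norm (f n x - f l x) \<le> norm (f n x - frechet_D g x h) + norm (f l x - frechet_D g x h)"
        using norm_triangle_ineq4[of "f n x - frechet_D g x h" "f l x - frechet_D g x h"] by simp
      then show "norm (f n x - f l x) \<le> K * e n + K * e l"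
        using f_approx[OF x, of n] f_approx[OF x, of l] by linarith
    qed (use \<delta> in auto)
    moreover have "frechet_D (\<lambda>x. f n x - f l x) y = (\<lambda>v. f' n y v - f' l y v)"
      using \<delta> by (intro frechet_D_eqI der) auto
    ultimately show ?thesis by simp
  qed
  have e_lim: "e \<longlonglongrightarrow> 0"
    unfolding e_def using LIMSEQ_ignore_initial_segment[OF lim_1_over_n, of "Suc k"]
    by (simp add: add.commute)
  have K: "K \<ge> 0" using \<delta>' by (simp add: K_def)
  define g' where "g' y v = lim (\<lambda>n. f' n y v)" for y v
  have f'_lim: "(\<lambda>n. f' n y v) \<longlonglongrightarrow> g' y v" if y: "y \<in> ball z0 \<delta>" for y v
  proof -
    have "Cauchy (\<lambda>n. f' n y v)"
    proof (rule metric_CauchyI)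
      fix \<epsilon> :: real assume "\<epsilon> > 0"
      define C where "C = 4 * K / \<delta> * norm v"
      have C: "2 * (K * e m + K * e n) / \<delta> * norm v = (C * e m + C * e n) / 2" for m n
        using \<delta>(1) by (simp add: C_def field_simps)
      have "(\<lambda>n. C * e n) \<longlonglongrightarrow> 0"
        using tendsto_mult_right_zero[OF e_lim] by blast
      then have "\<forall>\<^sub>F n in sequentially. C * e n < \<epsilon>"
        using \<open>\<epsilon> > 0\<close> by (rule order_tendstoD)
      then obtain n0 where n0: "C * e n < \<epsilon>" if "n \<ge> n0" for n
        unfolding eventually_sequentially by blast
      show "\<exists>n0. \<forall>m\<ge>n0. \<forall>n\<ge>n0. dist (f' m y v) (f' n y v) < \<epsilon>"
      proof (intro exI allI impI)
        fix m n assume "m \<ge> n0" "n \<ge> n0"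
        then have "(C * e m + C * e n) / 2 < \<epsilon>"
          using n0[of m] n0[of n] by simp
        then have "2 * (K * e m + K * e n) / \<delta> * norm v < \<epsilon>"
          by (simp only: C)
        then show "dist (f' m y v) (f' n y v) < \<epsilon>"
          using f'_cauchy[OF y, of m v n] by (simp add: dist_norm)
      qed
    qed
    then show ?thesis
      unfolding g'_def by (simp add: Cauchy_convergent_iff convergent_LIMSEQ_iff)
  qed
  have f'_approx: "norm (f' n y v - g' y v) \<le> 2 * K * e n / \<delta> * norm v" if y: "y \<in> ball z0 \<delta>" for n y v
  proof (rule tendsto_le[OF _ _ tendsto_norm[OF tendsto_diff[OF tendsto_const f'_lim[OF y]]]])
    have "(\<lambda>l. 2 * (K * e n + K * e l) / \<delta> * norm v) \<longlonglongrightarrow> 2 * (K * e n + K * 0) / \<delta> * norm v"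
      using \<delta> by (intro tendsto_intros e_lim) auto
    then show "(\<lambda>l. 2 * (K * e n + K * e l) / \<delta> * norm v) \<longlonglongrightarrow> 2 * K * e n / \<delta> * norm v"
      by (simp add: mult.assoc)
  qed (use f'_cauchy[OF y] in auto)
  have f_lim: "(\<lambda>n. f n y) \<longlonglongrightarrow> frechet_D g y h" if "y \<in> ball z0 (2 * \<delta>)" for y
  proof (rule LIM_zero_cancel, rule Lim_null_comparison)
    show "\<forall>\<^sub>F n in sequentially. norm (f n y - frechet_D g y h) \<le> K * e n"
      using f_approx[OF that] by simp
    show "(\<lambda>n. K * e n) \<longlonglongrightarrow> 0"
      using tendsto_mult_right_zero[OF e_lim] by blast
  qed
  have "\<exists>G. \<forall>y\<in>ball z0 \<delta>. (\<lambda>n. f n y) \<longlonglongrightarrow> G y \<and> (G has_derivative g' y) (at y within ball z0 \<delta>)"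
  proof (rule has_derivative_sequence)
    fix n y assume "y \<in> ball z0 \<delta>"
    then show "(f n has_derivative f' n y) (at y within ball z0 \<delta>)"
      using \<delta> by (intro has_derivative_at_withinI[OF f_deriv]) auto
  next
    fix \<epsilon> :: real assume "\<epsilon> > 0"
    have "(\<lambda>n. 2 * K / \<delta> * e n) \<longlonglongrightarrow> 0"
      using tendsto_mult_right_zero[OF e_lim] by blast
    then have "\<forall>\<^sub>F n in sequentially. 2 * K / \<delta> * e n < \<epsilon>"
      using \<open>\<epsilon> > 0\<close> by (rule order_tendstoD)
    then show "\<forall>\<^sub>F n in sequentially. \<forall>y\<in>ball z0 \<delta>. \<forall>v. norm (f' n y v - g' y v) \<le> \<epsilon> * norm v"
    proof eventually_elim
      case (elim n)
      then have "2 * K * e n / \<delta> * norm v \<le> \<epsilon> * norm v" for v :: 'a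
        by (intro mult_right_mono) auto
      then show ?case using f'_approx order.trans by blast
    qed
  next
    show "z0 \<in> ball z0 \<delta>" using \<delta> by simp
  next
    show "(\<lambda>n. f n z0) \<longlonglongrightarrow> frechet_D g z0 h"
      using \<delta> by (intro f_lim) auto
  qed simp
  then obtain G where G: "(\<lambda>n. f n y) \<longlonglongrightarrow> G y" "(G has_derivative g' y) (at y within ball z0 \<delta>)"
    if "y \<in> ball z0 \<delta>" for y by blast
  have z0: "z0 \<in> ball z0 \<delta>" using \<delta> by simp
  have "(G has_derivative g' z0) (at z0)"
    using G(2)[OF z0] at_within_open[OF z0 open_ball] by simp
  then have "((\<lambda>z. frechet_D g z h) has_derivative g' z0) (at z0)"
  proof (rule has_derivative_transform_within_open[OF _ open_ball z0])
    fix y assume "y \<in> ball z0 \<delta>"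
    then show "G y = frechet_D g y h"
      using LIMSEQ_unique[OF G(1) f_lim, of y] \<delta> by auto
  qed
  moreover have "g' z0 (c *\<^sub>C v) = c *\<^sub>C g' z0 v" for c v
  proof (rule LIMSEQ_unique[OF f'_lim[OF z0]])
    show "(\<lambda>n. f' n z0 (c *\<^sub>C v)) \<longlonglongrightarrow> c *\<^sub>C g' z0 v"
      using bounded_linear.tendsto[OF bounded_linear_scaleC_right f'_lim[OF z0]] z0 \<delta>
      by (simp add: f'_scaleC)
  qed
  ultimately show "\<exists>L. ((\<lambda>z. frechet_D g z h) has_derivative L) (at z0) \<and> (\<forall>c x. L (c *\<^sub>C x) = c *\<^sub>C L x)"
    by blast
qed

section \<open>Higher Frechet derivatives of holomorphic maps\<close>

lemma prod_norm_nonneg: "0 \<le> (\<Prod>w\<leftarrow>ws. norm w)"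
  by (intro prod_list_nonneg) auto

lemma prod_norm_le_1: "set ws \<subseteq> cball 0 1 \<Longrightarrow> (\<Prod>w\<leftarrow>ws. norm w) \<le> (1::real)"
  by (induction ws) (auto intro!: mult_le_one simp: prod_norm_nonneg)

text \<open>
  The invariant under which differentiation can be iterated. The last clause is local boundedness of
  \<open>G\<close> in the norm of \<open>k\<close>-linear maps; it is needed because the second clause treats each argument list
  \<open>ws\<close> separately.
\<close>

definition multi_holomorphic_on :: "nat \<Rightarrow> ('a::complex_banach \<Rightarrow> 'a list \<Rightarrow> 'b::complex_banach) \<Rightarrow> 'a set \<Rightarrow> bool"
  where "multi_holomorphic_on k G U \<longleftrightarrow>
     (\<forall>z\<in>U. bounded_cmultilinear k (G z)) \<and>
     (\<forall>ws. length ws = k \<longrightarrow> holomorphic_map_on (\<lambda>z. G z ws) U) \<and>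
     (\<forall>z\<in>U. \<exists>\<delta>>0. \<exists>M\<ge>0. ball z \<delta> \<subseteq> U \<and>
        (\<forall>y\<in>ball z \<delta>. \<forall>ws. length ws = k \<longrightarrow> norm (G y ws) \<le> M * (\<Prod>w\<leftarrow>ws. norm w)))"

lemma frechet_D_add:
  assumes "holomorphic_map_on f U" "holomorphic_map_on g U" "z \<in> U" "open U"
    and "\<And>y. y \<in> U \<Longrightarrow> e y = f y + g y"
  shows "frechet_D e z h = frechet_D f z h + frechet_D g z h"
proof -
  have "((\<lambda>y. f y + g y) has_derivative (\<lambda>h. frechet_D f z h + frechet_D g z h)) (at z)"
    using assms by (intro has_derivative_add holomorphic_map_has_derivative)
  then have "(e has_derivative (\<lambda>h. frechet_D f z h + frechet_D g z h)) (at z)"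
    by (rule has_derivative_transform_within_open[OF _ assms(4,3)]) (simp add: assms(5))
  from frechet_D_eqI[OF this] show ?thesis by simp
qed

lemma frechet_D_scale:
  assumes "holomorphic_map_on f U" "z \<in> U" "open U"
    and "\<And>y. y \<in> U \<Longrightarrow> e y = c *\<^sub>C f y"
  shows "frechet_D e z h = c *\<^sub>C frechet_D f z h"
proof -
  have "((\<lambda>y. c *\<^sub>C f y) has_derivative (\<lambda>h. c *\<^sub>C frechet_D f z h)) (at z)"
    using bounded_linear.has_derivative[OF bounded_linear_scaleC_right
        holomorphic_map_has_derivative[OF assms(1,2)]] .
  then have "(e has_derivative (\<lambda>h. c *\<^sub>C frechet_D f z h)) (at z)"
    by (rule has_derivative_transform_within_open[OF _ assms(3,2)]) (simp add: assms(4))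
  from frechet_D_eqI[OF this] show ?thesis by simp
qed

text \<open>
  Local boundedness passes to the derivative: the bound holds for all argument lists at once and on a
  ball that does not depend on them.
\<close>

lemma frechet_D_bound_on_half_ball:
  assumes hol: "\<And>ws. length ws = k \<Longrightarrow> holomorphic_map_on (\<lambda>z. G z ws) U"
    and \<delta>: "\<delta> > 0" "ball z \<delta> \<subseteq> U"
    and bound: "\<And>y ws. y \<in> ball z \<delta> \<Longrightarrow> length ws = k \<Longrightarrow> norm (G y ws) \<le> M * (\<Prod>w\<leftarrow>ws. norm w)"
    and y: "y \<in> ball z (\<delta> / 2)" and ws: "length ws = k"
  shows "norm (frechet_D (\<lambda>z. G z ws) y h) \<le> 4 * M / \<delta> * (\<Prod>w\<leftarrow>h # ws. norm w)"
proof -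
  have sub: "ball y (\<delta> / 2) \<subseteq> ball z \<delta>"
  proof
    fix x assume "x \<in> ball y (\<delta> / 2)"
    then show "x \<in> ball z \<delta>"
      using y dist_triangle[of z x y] by auto
  qed
  have "norm (frechet_D (\<lambda>z. G z ws) y h) \<le> 2 * (M * (\<Prod>w\<leftarrow>ws. norm w)) / (\<delta> / 2) * norm h"
  proof (rule cauchy_estimate_map)
    show "holomorphic_map_on (\<lambda>z. G z ws) (ball y (\<delta> / 2))"
      using hol[OF ws] sub \<delta> by (blast intro: holomorphic_map_on_subset)
  qed (use \<delta> bound[OF _ ws] sub in auto)
  also have "\<dots> = 4 * M / \<delta> * (\<Prod>w\<leftarrow>h # ws. norm w)"
    using \<delta> by (simp add: field_simps)
  finally show ?thesis .
qed

text \<open>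
  By \<open>taylor_remainder_map\<close> the remainder is at most \<open>32 * M / \<delta>\<^sup>2 * (norm h)\<^sup>2\<close> for all argument
  lists from the closed unit ball, where \<open>M\<close> is the local bound of the invariant. Linearity in the later
  arguments holds because differentiation respects sums and multiples.
\<close>

lemma multi_holomorphic_has_multi_derivative:
  assumes G: "multi_holomorphic_on k G U" and "open U" and z: "z \<in> U"
  shows "has_multi_derivative k G (\<lambda>ws. frechet_D (\<lambda>z. G z (tl ws)) z (hd ws)) z"
    (is "has_multi_derivative k G ?L z")
proof -
  have ml: "bounded_cmultilinear k (G y)" if "y \<in> U" for y
    using G that by (auto simp: multi_holomorphic_on_def)
  have hol: "holomorphic_map_on (\<lambda>z. G z ws) U" if "length ws = k" for ws
    using G that by (auto simp: multi_holomorphic_on_def)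
  obtain \<delta> M where \<delta>: "\<delta> > 0" "M \<ge> 0" "ball z \<delta> \<subseteq> U"
    and bound: "\<And>y ws. y \<in> ball z \<delta> \<Longrightarrow> length ws = k \<Longrightarrow> norm (G y ws) \<le> M * (\<Prod>w\<leftarrow>ws. norm w)"
    using G z unfolding multi_holomorphic_on_def by metis
  have "bounded_cmultilinear (Suc k) ?L"
    unfolding bounded_cmultilinear_def
  proof (intro conjI allI impI)
    fix xs ys :: "'a list" and u v c
    assume len: "length xs + 1 + length ys = Suc k"
    show "?L (xs @ (u + v) # ys) = ?L (xs @ u # ys) + ?L (xs @ v # ys)"
    proof (cases xs)
      case Nil
      then show ?thesis
        using len frechet_D_add_direction[OF hol z, of ys u v] by simp
    next
      case (Cons x xs')
      then have len': "length xs' + 1 + length ys = k" using len by simp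
      have "frechet_D (\<lambda>z. G z (xs' @ (u + v) # ys)) z x =
          frechet_D (\<lambda>z. G z (xs' @ u # ys)) z x + frechet_D (\<lambda>z. G z (xs' @ v # ys)) z x"
        using len' by (intro frechet_D_add[OF hol hol z \<open>open U\<close>] bounded_cmultilinearD(1)[OF ml]) auto
      then show ?thesis by (simp add: Cons)
    qed
    show "?L (xs @ (c *\<^sub>C u) # ys) = c *\<^sub>C ?L (xs @ u # ys)"
    proof (cases xs)
      case Nil
      then show ?thesis
        using len frechet_D_scaleC[OF hol z, of ys c u] by simp
    next
      case (Cons x xs')
      then have len': "length xs' + 1 + length ys = k" using len by simp
      have "frechet_D (\<lambda>z. G z (xs' @ (c *\<^sub>C u) # ys)) z x = c *\<^sub>C frechet_D (\<lambda>z. G z (xs' @ u # ys)) z x"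
        using len' by (intro frechet_D_scale[OF hol z \<open>open U\<close>] bounded_cmultilinearD(2)[OF ml]) auto
      then show ?thesis by (simp add: Cons)
    qed
  next
    have "norm (?L ws) \<le> 4 * M / \<delta> * (\<Prod>w\<leftarrow>ws. norm w)" if len: "length ws = Suc k" for ws
    proof -
      obtain h vs where ws: "ws = h # vs" "length vs = k"
        using len by (auto simp: length_Suc_conv)
      have "norm (frechet_D (\<lambda>z. G z vs) z h) \<le> 4 * M / \<delta> * (\<Prod>w\<leftarrow>h # vs. norm w)"
        by (rule frechet_D_bound_on_half_ball[OF hol \<delta>(1,3) bound]) (use \<delta> ws in auto)
      then show ?thesis by (simp add: ws)
    qed
    then show "\<exists>K. \<forall>ws. length ws = Suc k \<longrightarrow> norm (?L ws) \<le> K * (\<Prod>w\<leftarrow>ws. norm w)"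
      by blast
  qed
  moreover have "uniform_limit {ws. length ws = k \<and> set ws \<subseteq> cball 0 1}
       (\<lambda>h ws. (G (z + h) ws - G z ws - ?L (h # ws)) /\<^sub>R norm h) (\<lambda>ws. 0) (at 0)"
    unfolding uniform_limit_iff
  proof (intro allI impI)
    fix e :: real assume e: "e > 0"
    define K where "K = 32 * M / \<delta> ^ 2"
    have K: "K \<ge> 0" using \<delta> by (simp add: K_def)
    define d where "d = min (\<delta> / 2) (e / (K + 1))"
    have d: "d > 0" using \<delta> e K by (simp add: d_def)
    have "dist ((G (z + h) ws - G z ws - ?L (h # ws)) /\<^sub>R norm h) 0 < e"
      if h: "h \<noteq> 0" "norm h < d" and ws: "length ws = k" "set ws \<subseteq> cball 0 1" for h ws
    proof -
      have "norm (G (z + h) ws - G z ws - frechet_D (\<lambda>z. G z ws) z h) \<le> 32 * M / \<delta> ^ 2 * norm h ^ 2"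
      proof (rule taylor_remainder_map)
        show "holomorphic_map_on (\<lambda>z. G z ws) (ball z \<delta>)"
          using hol[OF ws(1)] \<delta>(3) by (rule holomorphic_map_on_subset)
        fix y assume y: "y \<in> ball z \<delta>"
        have "M * (\<Prod>w\<leftarrow>ws. norm w) \<le> M"
          using \<delta>(2) prod_norm_le_1[OF ws(2)] by (rule mult_left_le[rotated])
        then show "norm (G y ws) \<le> M"
          using bound[OF y ws(1)] by linarith
      qed (use h \<delta> in \<open>auto simp: d_def\<close>)
      then have "norm (G (z + h) ws - G z ws - frechet_D (\<lambda>z. G z ws) z h) / norm h \<le> K * norm h"
        unfolding K_def[symmetric] using h by (simp add: pos_divide_le_eq power2_eq_square mult.assoc)
      also have "\<dots> \<le> K * (e / (K + 1))"
        using h K by (intro mult_left_mono) (auto simp: d_def)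
      also have "\<dots> < e"
        using K e by (simp add: field_simps)
      finally show ?thesis
        by (simp add: divide_inverse_commute)
    qed
    then show "\<forall>\<^sub>F h in at 0. \<forall>ws\<in>{ws. length ws = k \<and> set ws \<subseteq> cball 0 1}.
        dist ((G (z + h) ws - G z ws - ?L (h # ws)) /\<^sub>R norm h) 0 < e"
      unfolding eventually_at using d by (intro exI[of _ d]) auto
  qed
  ultimately show ?thesis
    unfolding has_multi_derivative_def by blast
qed

text \<open>
  Once some derivative exists, uniqueness identifies the one chosen in the definition of
  \<^const>\<open>nth_frechet\<close> with the directional derivative.
\<close>

lemma nth_frechet_Suc:
  assumes G: "multi_holomorphic_on k (nth_frechet k F) U" and "open U" and z: "z \<in> U"
  shows "has_multi_derivative k (nth_frechet k F) (nth_frechet (Suc k) F z) z"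
    and "length ws = k \<Longrightarrow> nth_frechet (Suc k) F z (h # ws) = frechet_D (\<lambda>z. nth_frechet k F z ws) z h"
proof -
  note L = multi_holomorphic_has_multi_derivative[OF assms]
  show 1: "has_multi_derivative k (nth_frechet k F) (nth_frechet (Suc k) F z) z"
    unfolding nth_frechet.simps using L by (rule someI[of "\<lambda>L. has_multi_derivative k (nth_frechet k F) L z"])
  show "nth_frechet (Suc k) F z (h # ws) = frechet_D (\<lambda>z. nth_frechet k F z ws) z h" if "length ws = k"
    using has_multi_derivative_unique[OF 1 L, of "h # ws"] that by simp
qed

lemma holomorphic_map_on_cong:
  assumes "holomorphic_map_on f U" "open U" "\<And>y. y \<in> U \<Longrightarrow> g y = f y"
  shows "holomorphic_map_on g U"
proof (rule holomorphic_map_onI)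
  fix z assume z: "z \<in> U"
  show "(g has_derivative frechet_D f z) (at z)"
    by (rule has_derivative_transform_within_open[OF holomorphic_map_has_derivative[OF assms(1) z] assms(2) z])
      (simp add: assms(3))
qed (rule frechet_D_scaleC[OF assms(1)])

lemma multi_holomorphic_nth_frechet:
  assumes hol: "holomorphic_map_on F U" and "open U"
  shows "multi_holomorphic_on k (nth_frechet k F) U"
proof (induction k)
  case 0
  have "bounded_cmultilinear 0 (\<lambda>ws::'a list. F z)" for z
    unfolding bounded_cmultilinear_def by auto
  moreover have "\<exists>\<delta>>0. \<exists>M\<ge>0. ball z \<delta> \<subseteq> U \<and> (\<forall>y\<in>ball z \<delta>. norm (F y) \<le> M)" if "z \<in> U" for z
    using holomorphic_map_locally_bounded[OF hol \<open>open U\<close> that] by metis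
  ultimately show ?case
    using hol by (simp add: multi_holomorphic_on_def)
next
  case (Suc k)
  note D = nth_frechet_Suc[OF Suc.IH \<open>open U\<close>]
  have holk: "holomorphic_map_on (\<lambda>z. nth_frechet k F z ws) U" if "length ws = k" for ws
    using Suc.IH that by (auto simp: multi_holomorphic_on_def)
  show ?case
    unfolding multi_holomorphic_on_def
  proof (intro conjI ballI allI impI)
    fix z assume z: "z \<in> U"
    show "bounded_cmultilinear (Suc k) (nth_frechet (Suc k) F z)"
      using D(1)[OF z] by (simp add: has_multi_derivative_def del: nth_frechet.simps)
    obtain \<delta> M where \<delta>: "\<delta> > 0" "M \<ge> 0" "ball z \<delta> \<subseteq> U"
      and bound: "\<And>y ws. y \<in> ball z \<delta> \<Longrightarrow> length ws = k \<Longrightarrow>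
        norm (nth_frechet k F y ws) \<le> M * (\<Prod>w\<leftarrow>ws. norm w)"
      using Suc.IH z unfolding multi_holomorphic_on_def by metis
    have "norm (nth_frechet (Suc k) F y ws) \<le> 4 * M / \<delta> * (\<Prod>w\<leftarrow>ws. norm w)"
      if y: "y \<in> ball z (\<delta> / 2)" and ws: "length ws = Suc k" for y ws
    proof -
      obtain h vs where vs: "ws = h # vs" "length vs = k"
        using ws by (auto simp: length_Suc_conv)
      have "y \<in> U" using y \<delta> by auto
      then show ?thesis
        using frechet_D_bound_on_half_ball[OF holk \<delta>(1,3) bound y vs(2), of h] D(2)[of y vs h] vs
        by (simp del: nth_frechet.simps)
    qed
    then show "\<exists>\<delta>>0. \<exists>M\<ge>0. ball z \<delta> \<subseteq> U \<and>
        (\<forall>y\<in>ball z \<delta>. \<forall>ws. length ws = Suc k \<longrightarrow>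
           norm (nth_frechet (Suc k) F y ws) \<le> M * (\<Prod>w\<leftarrow>ws. norm w))"
      using \<delta> by (intro exI[of _ "\<delta> / 2"] conjI exI[of _ "4 * M / \<delta>"]) (auto simp del: nth_frechet.simps)
  next
    fix ws :: "'a list" assume "length ws = Suc k"
    then obtain h vs where vs: "ws = h # vs" "length vs = k"
      by (auto simp: length_Suc_conv)
    show "holomorphic_map_on (\<lambda>z. nth_frechet (Suc k) F z ws) U"
      by (rule holomorphic_map_on_cong[OF holomorphic_map_frechet_D[OF holk[OF vs(2)] \<open>open U\<close>] \<open>open U\<close>])
        (simp add: D(2) vs del: nth_frechet.simps)
  qed
qed

text \<open>
  The bridge to one variable: on the diagonal, higher Frechet derivatives are ordinary higher derivatives
  along a line.
\<close>

lemma higher_deriv_along_line: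
  assumes hol: "holomorphic_map_on F U" and "open U" and \<psi>: "contractive_functional \<psi>"
    and t: "z + t *\<^sub>C x \<in> U"
  shows "(deriv ^^ k) (\<lambda>s. \<psi> (F (z + s *\<^sub>C x))) t = \<psi> (nth_frechet k F (z + t *\<^sub>C x) (replicate k x))"
  using t
proof (induction k arbitrary: t)
  case (Suc k)
  note G = multi_holomorphic_nth_frechet[OF hol \<open>open U\<close>, of k]
  have holk: "holomorphic_map_on (\<lambda>y. nth_frechet k F y (replicate k x)) U"
    using G by (auto simp: multi_holomorphic_on_def)
  define V where "V = (\<lambda>s. z + s *\<^sub>C x) -` U"
  have "continuous_on UNIV (\<lambda>s. z + s *\<^sub>C x)"
    by (intro continuous_intros linear_continuous_on bounded_linear_scaleC_left)
  then have "open V"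
    unfolding V_def using \<open>open U\<close> by (intro open_vimage)
  have "((\<lambda>s. \<psi> (nth_frechet k F (z + s *\<^sub>C x) (replicate k x))) has_field_derivative
      \<psi> (nth_frechet (Suc k) F (z + t *\<^sub>C x) (replicate (Suc k) x))) (at t)"
    using has_field_derivative_along_line[OF holk \<psi> Suc.prems] nth_frechet_Suc(2)[OF G \<open>open U\<close> Suc.prems]
    by (simp del: nth_frechet.simps)
  then have "((deriv ^^ k) (\<lambda>s. \<psi> (F (z + s *\<^sub>C x))) has_field_derivative
      \<psi> (nth_frechet (Suc k) F (z + t *\<^sub>C x) (replicate (Suc k) x))) (at t)"
    by (rule has_field_derivative_transform_within_open[OF _ \<open>open V\<close>])
      (use Suc in \<open>auto simp: V_def\<close>)
  then show ?case
    by (auto dest: DERIV_imp_deriv)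
qed simp

section \<open>The Schwarz lemma of higher order and coefficient bounds\<close>

text \<open>
  This is the Schwarz lemma; values of modulus one are excluded by the maximum principle because
  \<open>f 0 = 0\<close>.
\<close>

lemma divide_by_z_unit_disc:
  assumes hol: "f holomorphic_on ball 0 1" and le: "\<And>t. t \<in> ball 0 1 \<Longrightarrow> cmod (f t) \<le> 1" and f0: "f 0 = 0"
  obtains g where "g holomorphic_on ball 0 1" "\<And>t. t \<in> ball 0 1 \<Longrightarrow> f t = t * g t"
    "\<And>t. t \<in> ball 0 1 \<Longrightarrow> cmod (g t) \<le> 1"
proof -
  have lt: "cmod (f t) < 1" if t: "cmod t < 1" for t
  proof (rule ccontr)
    assume "\<not> cmod (f t) < 1"
    then have max: "cmod (f s) \<le> cmod (f t)" if "s \<in> ball 0 1" for s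
      using le[OF that] by simp
    have "f constant_on ball 0 1"
      using t max by (intro maximum_modulus_principle[OF hol, of "ball 0 1" t]) auto
    then have "f t = f 0"
      using t by (auto simp: constant_on_def)
    with \<open>\<not> cmod (f t) < 1\<close> f0 show False by simp
  qed
  note S = Schwarz_Lemma[OF hol f0 lt]
  obtain g where g: "g holomorphic_on ball 0 1" "\<And>t. cmod t < 1 \<Longrightarrow> f t = t * g t" "deriv f 0 = g 0"
    by (rule Schwarz3[OF hol f0]) auto
  have "cmod (g t) \<le> 1" if t: "t \<in> ball 0 1" for t
  proof (cases "t = 0")
    case True
    then show ?thesis using S(2)[of 0] g(3) by simp
  next
    case False
    then show ?thesis using S(1)[of t] t g(2)[of t] by (simp add: norm_mult)
  qed
  with g show ?thesis by (intro that[of g]) auto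
qed

text \<open>
  Divide by the variable \<open>m\<close> times. The coefficient of order \<open>m\<close> is the value at \<open>0\<close> of the last
  quotient.
\<close>

lemma schwarz_higher_order:
  assumes "f holomorphic_on ball 0 1" "\<And>t. t \<in> ball 0 1 \<Longrightarrow> cmod (f t) \<le> 1"
    and "f has_fps_expansion A" "\<And>j. j < m \<Longrightarrow> fps_nth A j = 0"
  shows "(\<forall>t\<in>ball 0 1. cmod (f t) \<le> cmod t ^ m) \<and> cmod (fps_nth A m) \<le> 1"
  using assms
proof (induction m arbitrary: f A)
  case 0
  then show ?case
    using has_fps_expansion_imp_0_eq_fps_nth_0[of f A] "0.prems"(2)[of 0] by auto
next
  case (Suc m)
  have "f 0 = 0"
    using has_fps_expansion_imp_0_eq_fps_nth_0[OF Suc.prems(3)] Suc.prems(4)[of 0] by simp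
  with Suc.prems obtain g where g: "g holomorphic_on ball 0 1" "\<And>t. t \<in> ball 0 1 \<Longrightarrow> f t = t * g t"
    "\<And>t. t \<in> ball 0 1 \<Longrightarrow> cmod (g t) \<le> 1"
    using divide_by_z_unit_disc by metis
  define B where "B = fps_expansion g 0"
  have B: "g has_fps_expansion B"
    unfolding B_def using g(1) by (intro has_fps_expansion_fps_expansion) auto
  have "(\<lambda>t. t * g t) has_fps_expansion fps_X * B"
    by (intro fps_expansion_intros B)
  moreover have "eventually (\<lambda>t. t * g t = f t) (nhds 0)"
    using eventually_nhds_in_open[of "ball 0 1" "0::complex"] by (auto elim!: eventually_mono simp: g(2))
  ultimately have "f has_fps_expansion fps_X * B"
    using has_fps_expansion_cong by fast
  then have AB: "A = fps_X * B"
    using Suc.prems(3) by (rule fps_expansion_unique_complex[rotated])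
  have IH: "(\<forall>t\<in>ball 0 1. cmod (g t) \<le> cmod t ^ m) \<and> cmod (fps_nth B m) \<le> 1"
  proof (rule Suc.IH[OF g(1,3) B])
    show "fps_nth B j = 0" if "j < m" for j
      using Suc.prems(4)[of "Suc j"] that by (simp add: AB)
  qed
  then have "cmod (f t) \<le> cmod t ^ Suc m" if "t \<in> ball 0 1" for t
    using that by (auto simp: g(2) norm_mult intro!: mult_left_mono)
  then show ?case using IH by (simp add: AB)
qed

lemma sum_powers_root_of_unity:
  assumes "0 < k" "k < n"
  shows "(\<Sum>j<n. (cis (2 * pi / n) ^ j) ^ k) = 0"
proof -
  define w where "w = cis (2 * pi / n)"
  have wn: "w ^ n = 1"
    using assms by (simp add: w_def Complex.DeMoivre)
  define \<zeta> where "\<zeta> = w ^ k"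
  have "(w ^ j) ^ k = \<zeta> ^ j" for j
    by (simp only: \<zeta>_def power_mult[symmetric] mult.commute)
  then have "(\<Sum>j<n. (cis (2 * pi / n) ^ j) ^ k) = (\<Sum>j<n. \<zeta> ^ j)"
    by (simp add: w_def)
  moreover have "\<zeta> ^ n = 1"
    by (metis \<zeta>_def wn power_mult mult.commute power_one)
  moreover have "\<zeta> \<noteq> 1"
  proof
    assume "\<zeta> = 1"
    then have "cos (real k * (2 * pi / n)) = 1"
      by (simp add: \<zeta>_def w_def Complex.DeMoivre complex_eq_iff)
    then obtain i :: int where "real k * (2 * pi / n) = of_int i * 2 * pi"
      by (auto simp: cos_one_2pi_int)
    then have "real k = of_int i * real n"
      using assms by (simp add: field_simps)
    then have "int k = i * int n"
      by (metis of_int_eq_iff of_int_mult of_int_of_nat_eq)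
    then show False
      using assms by (metis dvd_triv_right int_dvd_int_iff nat_dvd_not_less)
  qed
  ultimately show ?thesis by (simp add: geometric_sum)
qed

lemma one_minus_mult_cnj_neq_0:
  assumes "cmod b < 1" "cmod p < 1"
  shows "1 - cnj b * p \<noteq> 0"
proof
  assume "1 - cnj b * p = 0"
  then have "cmod (cnj b * p) = 1" by simp
  moreover have "cmod b * cmod p \<le> cmod b"
    using assms by (intro mult_left_le) auto
  ultimately show False using assms by (simp add: norm_mult)
qed

lemma moebius_in_unit_disc:
  assumes "cmod b < 1" "cmod p < 1"
  shows "cmod ((p - b) / (1 - cnj b * p)) < 1"
proof -
  have "(cmod (1 - cnj b * p))\<^sup>2 - (cmod (p - b))\<^sup>2 = (1 - (cmod b)\<^sup>2) * (1 - (cmod p)\<^sup>2)"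
    unfolding cmod_power2 by (simp add: power2_eq_square algebra_simps)
  moreover have "0 < (1 - (cmod b)\<^sup>2) * (1 - (cmod p)\<^sup>2)"
    using assms by (intro mult_pos_pos) (auto simp: abs_square_less_1)
  ultimately have "cmod (p - b) < cmod (1 - cnj b * p)"
    by (intro power2_less_imp_less[of "cmod (p - b)" "cmod (1 - cnj b * p)"]) (linarith, simp)
  then show ?thesis
    using one_minus_mult_cnj_neq_0[OF assms] by (simp add: norm_divide divide_less_eq)
qed

text \<open>
  The disc automorphism that moves \<open>p 0\<close> to \<open>0\<close> turns \<open>p\<close> into a function \<open>q\<close> with a zero of order
  at least \<open>n\<close> whose \<open>n\<close>-th coefficient is \<open>P\<^sub>n / (1 - \<bar>p 0\<bar>\<^sup>2)\<close>; by the Schwarz lemma of order \<open>n\<close> this has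
  modulus at most \<open>1\<close>.
\<close>

lemma gap_coeff_bound:
  assumes hol: "p holomorphic_on ball 0 1" and lt: "\<And>t. t \<in> ball 0 1 \<Longrightarrow> cmod (p t) < 1"
    and P: "p has_fps_expansion P" and gap: "\<And>k. 0 < k \<Longrightarrow> k < n \<Longrightarrow> fps_nth P k = 0" and n: "n \<ge> 1"
  shows "cmod (fps_nth P n) \<le> 1 - cmod (p 0) ^ 2"
proof -
  define b where "b = p 0"
  have b: "cmod b < 1" using lt[of 0] by (simp add: b_def)
  have P0: "fps_nth P 0 = b"
    using has_fps_expansion_imp_0_eq_fps_nth_0[OF P] by (simp add: b_def)
  define R where "R = P - fps_const b"
  define D where "D = 1 - fps_const (cnj b) * P"
  have bb: "cnj b * b = of_real (cmod b ^ 2)"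
    by (simp add: complex_norm_square[symmetric] mult.commute)
  have bb1: "cmod b ^ 2 < 1" using b by (simp add: power_less_one_iff abs_square_less_1)
  have D0: "fps_nth D 0 = of_real (1 - cmod b ^ 2)"
    by (simp add: D_def P0 bb)
  have D0': "fps_nth D 0 \<noteq> 0" using bb1 unfolding D0 by (metis of_real_eq_0_iff diff_gt_0_iff_gt less_irrefl)
  define q where "q t = (p t - b) * inverse (1 - cnj b * p t)" for t
  have Q: "q has_fps_expansion R * inverse D"
    unfolding q_def R_def D_def using D0' unfolding D_def
    by (intro fps_expansion_intros P) auto
  have R: "fps_nth R k = 0" if "k < n" for k
    using that gap[of k] P0 by (cases k) (auto simp: R_def)
  have RD: "fps_nth (R * inverse D) j = (if j = n then fps_nth P n / fps_nth D 0 else 0)" if "j \<le> n" for j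
  proof -
    have "fps_nth (R * inverse D) j = (\<Sum>i=0..j. fps_nth R i * fps_nth (inverse D) (j - i))"
      by (rule fps_mult_nth)
    also have "\<dots> = (\<Sum>i=0..j. if i = n then fps_nth R i * fps_nth (inverse D) (j - i) else 0)"
      using that by (intro sum.cong) (auto simp: R)
    also have "\<dots> = (if j = n then fps_nth R n * fps_nth (inverse D) 0 else 0)"
      using that by (simp add: sum.delta')
    also have "\<dots> = (if j = n then fps_nth P n / fps_nth D 0 else 0)"
      using n by (simp add: R_def divide_inverse)
    finally show ?thesis .
  qed
  have "cmod (fps_nth (R * inverse D) n) \<le> 1"
  proof (rule conjunct2[OF schwarz_higher_order[OF _ _ Q]])
    show "q holomorphic_on ball 0 1"
      unfolding q_def using lt one_minus_mult_cnj_neq_0[OF b] by (intro holomorphic_intros hol) auto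
    show "cmod (q t) \<le> 1" if "t \<in> ball 0 1" for t
      using moebius_in_unit_disc[OF b lt[OF that]] by (simp add: q_def divide_inverse)
    show "fps_nth (R * inverse D) j = 0" if "j < n" for j
      using RD[of j] that by simp
  qed
  then have "cmod (fps_nth P n) \<le> cmod (fps_nth D 0)"
    using D0' by (simp add: RD norm_divide divide_le_eq)
  also have "\<dots> = 1 - cmod b ^ 2"
    unfolding D0 norm_of_real using bb1 by simp
  finally show ?thesis by (simp add: b_def)
qed

text \<open>
  Averaging \<open>f\<close> over rotations by the \<open>n\<close>-th roots of unity removes the coefficients of order strictly
  between \<open>0\<close> and \<open>n\<close> and keeps those of order \<open>0\<close> and \<open>n\<close>. A factor \<open>c < 1\<close> moves the values into
  the open disc, so that constants of modulus one are covered by the limit \<open>c \<rightarrow> 1\<close>.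
\<close>

lemma coeff_bound_unit_disc:
  assumes hol: "f holomorphic_on ball 0 1" and le: "\<And>t. t \<in> ball 0 1 \<Longrightarrow> cmod (f t) \<le> 1"
    and A: "f has_fps_expansion A" and n: "n \<ge> 1"
  shows "cmod (fps_nth A n) \<le> 1 - cmod (f 0) ^ 2"
proof -
  have A0: "fps_nth A 0 = f 0"
    using has_fps_expansion_imp_0_eq_fps_nth_0[OF A] by simp
  define \<omega> where "\<omega> j = cis (2 * pi / n) ^ j" for j
  have \<omega>: "cmod (\<omega> j) = 1" for j by (simp add: \<omega>_def norm_power)
  have scaled: "c * cmod (fps_nth A n) \<le> 1 - (c * cmod (f 0)) ^ 2" if c: "0 < c" "c < 1" for c :: real
  proof -
    define p where "p t = (of_real c / of_nat n) * (\<Sum>j<n. f (\<omega> j * t))" for t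
    define P where "P = fps_const (of_real c / of_nat n) * (\<Sum>j<n. A oo (fps_const (\<omega> j) * fps_X))"
    have "(\<lambda>t. f (\<omega> j * t)) has_fps_expansion (A oo (fps_const (\<omega> j) * fps_X))" for j
    proof -
      have "(f \<circ> (\<lambda>t. \<omega> j * t)) has_fps_expansion (A oo (fps_const (\<omega> j) * fps_X))"
        by (intro fps_expansion_intros A) auto
      then show ?thesis by (simp add: o_def)
    qed
    then have P: "p has_fps_expansion P"
      unfolding p_def P_def by (intro fps_expansion_intros)
    have P_nth: "fps_nth P k = of_real c / of_nat n * (\<Sum>j<n. \<omega> j ^ k) * fps_nth A k" for k
      by (simp add: P_def fps_sum_nth fps_compose_linear sum_distrib_right)
    have in_ball: "\<omega> j * t \<in> ball 0 1" if "t \<in> ball 0 1" for t j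
      using that \<omega> by (simp add: norm_mult)
    have "cmod (fps_nth P n) \<le> 1 - cmod (p 0) ^ 2"
    proof (rule gap_coeff_bound[OF _ _ P _ n])
      have "(\<lambda>t. f (\<omega> j * t)) holomorphic_on ball 0 1" for j
      proof -
        have "(\<lambda>t. \<omega> j * t) ` ball 0 1 \<subseteq> ball 0 1" using in_ball by blast
        moreover have "(\<lambda>t. \<omega> j * t) holomorphic_on ball 0 1" by (intro holomorphic_intros)
        ultimately show ?thesis
          using holomorphic_on_compose_gen[OF _ hol] by (simp add: o_def)
      qed
      then show "p holomorphic_on ball 0 1"
        unfolding p_def by (intro holomorphic_intros)
    next
      fix t :: complex assume t: "t \<in> ball 0 1"
      have "cmod (\<Sum>j<n. f (\<omega> j * t)) \<le> (\<Sum>j<n. 1)"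
        using le in_ball[OF t] by (intro sum_norm_le) auto
      then have "cmod (p t) \<le> c"
        using n c by (simp add: p_def norm_mult norm_divide field_simps)
      then show "cmod (p t) < 1" using c by simp
    next
      fix k assume k: "0 < k" "k < n"
      show "fps_nth P k = 0"
        using sum_powers_root_of_unity[OF k] by (simp add: P_nth \<omega>_def)
    qed
    moreover have "\<omega> j ^ n = 1" for j
    proof -
      have "cis (2 * pi / n) ^ n = 1" using n by (simp add: Complex.DeMoivre)
      then show ?thesis
        by (metis \<omega>_def power_mult mult.commute power_one)
    qed
    then have "fps_nth P n = of_real c * fps_nth A n"
      using n by (simp add: P_nth)
    moreover have "p 0 = of_real c * f 0"
      using n by (simp add: p_def)
    ultimately show ?thesis
      using c by (simp add: norm_mult)
  qed
  show ?thesis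
  proof (rule tendsto_le[of "at_left (1::real)"])
    show "((\<lambda>c. c * cmod (fps_nth A n)) \<longlongrightarrow> cmod (fps_nth A n)) (at_left 1)"
      by (auto intro!: tendsto_eq_intros)
    show "((\<lambda>c. 1 - (c * cmod (f 0)) ^ 2) \<longlongrightarrow> 1 - cmod (f 0) ^ 2) (at_left 1)"
      by (auto intro!: tendsto_eq_intros)
    show "\<forall>\<^sub>F c in at_left 1. c * cmod (fps_nth A n) \<le> 1 - (c * cmod (f 0)) ^ 2"
      using eventually_at_left_real[of 0 "1::real"] by (auto elim!: eventually_mono intro: scaled)
  qed simp
qed

section \<open>Ruscheweyh's inequality\<close>

text \<open>
  The expansion in \<open>h\<close> of \<open>h / (1 - \<rho>\<^sup>2 - \<rho> h)\<close>. This is the image of \<open>\<rho> + h\<close> under the disc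
  automorphism \<open>\<zeta> \<mapsto> (\<zeta> - \<rho>) / (1 - \<rho> \<zeta>)\<close>, which moves \<open>\<rho>\<close> to \<open>0\<close>.
\<close>

definition disc_shift_fps :: "real \<Rightarrow> complex fps" where
  "disc_shift_fps \<rho> = Abs_fps (\<lambda>n. if n = 0 then 0 else of_real (\<rho> ^ (n - 1) / (1 - \<rho>\<^sup>2) ^ n))"

lemma disc_shift_fps_eq:
  assumes "0 \<le> \<rho>" "\<rho> < 1"
  shows "disc_shift_fps \<rho> * (fps_const (of_real (1 - \<rho>\<^sup>2)) - fps_const (of_real \<rho>) * fps_X) = fps_X"
proof -
  define r d where "r = complex_of_real \<rho>" and "d = complex_of_real (1 - \<rho>\<^sup>2)"
  have d: "d \<noteq> 0"
    unfolding d_def of_real_eq_0_iff using assms by (simp add: power2_eq_1_iff)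
  have nth: "fps_nth (disc_shift_fps \<rho>) n = (if n = 0 then 0 else r ^ (n - 1) / d ^ n)" for n
    by (simp add: disc_shift_fps_def r_def d_def)
  have "disc_shift_fps \<rho> * (fps_const d - fps_const r * fps_X) =
      fps_const d * disc_shift_fps \<rho> - fps_const r * (fps_X * disc_shift_fps \<rho>)"
    by (simp add: algebra_simps)
  also have "\<dots> = fps_X"
  proof (rule fps_ext)
    fix n
    consider "n = 0" | "n = 1" | k where "n = Suc (Suc k)"
      by (metis One_nat_def not0_implies_Suc)
    then show "fps_nth (fps_const d * disc_shift_fps \<rho> - fps_const r * (fps_X * disc_shift_fps \<rho>)) n
        = fps_nth fps_X n"
      using d by cases (auto simp: nth)
  qed
  finally show ?thesis by (simp only: r_def d_def)
qed

lemma fps_power_nonneg_Reals: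
  fixes F :: "complex fps"
  assumes "\<And>k. fps_nth F k \<in> \<real>\<^sub>\<ge>\<^sub>0"
  shows "fps_nth (F ^ i) k \<in> \<real>\<^sub>\<ge>\<^sub>0"
proof (induction i arbitrary: k)
  case (Suc i)
  have "sum f {0..k} \<in> \<real>\<^sub>\<ge>\<^sub>0" if "\<And>j. f j \<in> \<real>\<^sub>\<ge>\<^sub>0" for f :: "nat \<Rightarrow> complex"
    using that by (induction k) auto
  then show ?case
    using assms Suc by (simp add: fps_mult_nth)
qed (auto simp: fps_one_nth)

text \<open>
  With \<open>W\<close> the series above, all coefficients of powers of \<open>W\<close> are nonnegative, so the moduli can be
  dropped and the sum is a coefficient of \<open>W + W\<^sup>2 + \<dots> = W / (1 - W)\<close>. This quotient simplifies to
  \<open>h / ((1 + \<rho>) (1 - \<rho> - h))\<close>, a geometric series.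
\<close>

lemma sum_disc_shift_powers:
  assumes \<rho>: "0 \<le> \<rho>" "\<rho> < 1" and k: "k \<ge> 1"
  shows "(\<Sum>i=1..k. cmod (fps_nth (disc_shift_fps \<rho> ^ i) k)) = 1 / ((1 + \<rho>) * (1 - \<rho>) ^ k)"
proof -
  define W where "W = disc_shift_fps \<rho>"
  define D where "D = fps_const (complex_of_real (1 - \<rho>\<^sup>2)) - fps_const (of_real \<rho>) * fps_X"
  define J where "J = Abs_fps (\<lambda>n. if n = 0 then 0 else (1::complex))"
  define T where "T = Abs_fps (\<lambda>n. if n = 0 then 0 else complex_of_real (1 / ((1 + \<rho>) * (1 - \<rho>) ^ n)))"
  have d: "1 - \<rho>\<^sup>2 = (1 + \<rho>) * (1 - \<rho>)" by (simp add: power2_eq_square algebra_simps)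
  have W0: "fps_nth W 0 = 0" by (simp add: W_def disc_shift_fps_def)
  have WD: "W * D = fps_X"
    unfolding W_def D_def by (rule disc_shift_fps_eq[OF \<rho>])
  have "J * (1 - fps_X) = fps_X"
  proof (rule fps_ext)
    fix n
    have "J * (1 - fps_X) = J - fps_X * J" by (simp add: algebra_simps)
    then show "fps_nth (J * (1 - fps_X)) n = fps_nth fps_X n"
      by (cases n) (auto simp: J_def)
  qed
  then have "(J * (1 - fps_X)) oo W = fps_X oo W" by simp
  then have "(J oo W) * (1 - W) = W"
    by (simp add: fps_compose_mult_distrib[OF W0] fps_compose_sub_distrib W0)
  then have "(J oo W) * (1 - W) * D = fps_X"
    using WD by simp
  moreover have "(1 - W) * D = D - fps_X"
    using WD by (simp add: algebra_simps)
  ultimately have JW: "(J oo W) * (D - fps_X) = fps_X"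
    by (simp add: mult.assoc)
  have TD: "T * (D - fps_X) = fps_X"
  proof -
    define a b where "a = complex_of_real (1 + \<rho>)" and "b = complex_of_real (1 - \<rho>)"
    have ab: "a \<noteq> 0" "b \<noteq> 0"
      unfolding a_def b_def of_real_eq_0_iff using \<rho> by auto
    have nth: "fps_nth T n = (if n = 0 then 0 else 1 / (a * b ^ n))" for n
      by (simp add: T_def a_def b_def)
    have "D - fps_X = fps_const (a * b) - fps_const a * fps_X"
      by (simp add: D_def d a_def b_def algebra_simps flip: fps_const_add)
    then have "T * (D - fps_X) = fps_const (a * b) * T - fps_const a * (fps_X * T)"
      by (simp only:) (simp only: right_diff_distrib mult_ac)
    also have "\<dots> = fps_X"
    proof (rule fps_ext)
      fix n
      consider "n = 0" | "n = 1" | j where "n = Suc (Suc j)"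
        by (metis One_nat_def not0_implies_Suc)
      then show "fps_nth (fps_const (a * b) * T - fps_const a * (fps_X * T)) n = fps_nth fps_X n"
        using ab by cases (auto simp: nth)
    qed
    finally show ?thesis .
  qed
  have "fps_nth (D - fps_X) 0 = complex_of_real (1 - \<rho>\<^sup>2)"
    by (simp add: D_def)
  moreover have "complex_of_real (1 - \<rho>\<^sup>2) \<noteq> 0"
    unfolding of_real_eq_0_iff d using \<rho> by auto
  ultimately have "fps_nth (D - fps_X) 0 \<noteq> 0" by simp
  then have "D - fps_X \<noteq> 0" by auto
  then have "J oo W = T"
    using JW TD by (metis mult_right_cancel)
  then have "of_real (1 / ((1 + \<rho>) * (1 - \<rho>) ^ k)) = fps_nth (J oo W) k"
    using k by (simp add: T_def)
  also have "\<dots> = (\<Sum>i=0..k. fps_nth J i * fps_nth (W ^ i) k)"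
    by (rule fps_compose_nth)
  also have "\<dots> = (\<Sum>i=1..k. fps_nth (W ^ i) k)"
    by (simp add: sum.atLeast_Suc_atMost J_def)
  finally have "(\<Sum>i=1..k. Re (fps_nth (W ^ i) k)) = 1 / ((1 + \<rho>) * (1 - \<rho>) ^ k)"
    by (metis Re_sum Re_complex_of_real)
  moreover have "cmod (fps_nth (W ^ i) k) = Re (fps_nth (W ^ i) k)" for i
  proof -
    have "fps_nth W n \<in> \<real>\<^sub>\<ge>\<^sub>0" for n
    proof -
      have "\<rho> ^ (n - 1) / (1 - \<rho>\<^sup>2) ^ n \<ge> 0"
        using \<rho> by (intro divide_nonneg_nonneg zero_le_power) (auto simp: power_le_one)
      then show ?thesis
        by (simp add: W_def disc_shift_fps_def del: of_real_divide of_real_power)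
    qed
    then have "fps_nth (W ^ i) k \<in> \<real>\<^sub>\<ge>\<^sub>0"
      by (rule fps_power_nonneg_Reals)
    then show ?thesis
      by (auto simp: complex_nonneg_Reals_iff cmod_eq_Re)
  qed
  ultimately show ?thesis by (simp add: W_def)
qed

text \<open>
  Write \<open>f (\<rho> + h) = g (W h)\<close>, where \<open>W\<close> is as above and \<open>g\<close> is \<open>f\<close> after a disc automorphism with
  \<open>g 0 = f \<rho>\<close>. The coefficient of \<open>h\<^sup>k\<close> is a combination of the coefficients \<open>1, \<dots>, k\<close> of \<open>g\<close>, of
  modulus at most \<open>1 - \<bar>f \<rho>\<bar>\<^sup>2\<close>, with nonnegative weights whose sum is \<open>sum_disc_shift_powers\<close>.
\<close>

lemma ruscheweyh_inequality:
  assumes hol: "f holomorphic_on ball 0 1" and le: "\<And>t. t \<in> ball 0 1 \<Longrightarrow> cmod (f t) \<le> 1"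
    and \<rho>: "0 \<le> \<rho>" "\<rho> < 1" and k: "k \<ge> 1"
  shows "cmod ((deriv ^^ k) f (of_real \<rho>) / fact k) \<le> (1 - cmod (f (of_real \<rho>)) ^ 2) / ((1 + \<rho>) * (1 - \<rho>) ^ k)"
proof -
  define d where "d = 1 - \<rho>\<^sup>2"
  have d: "d \<ge> 1 - \<rho>" "d > 0"
  proof -
    have "\<rho>\<^sup>2 \<le> \<rho>" using \<rho> by (simp add: power2_eq_square mult_left_le)
    then show "d \<ge> 1 - \<rho>" "d > 0" using \<rho> by (auto simp: d_def)
  qed
  define g where "g u = f ((u - (- of_real \<rho>)) / (1 - cnj (- of_real \<rho>) * u))" for u
  define B where "B = fps_expansion g 0"
  define \<omega> where "\<omega> h = h / (of_real d - of_real \<rho> * h)" for h :: complex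
  have \<rho>1: "cmod (- of_real \<rho>) < 1" using \<rho> by simp
  have in_disc: "(u - (- of_real \<rho>)) / (1 - cnj (- of_real \<rho>) * u) \<in> ball 0 1" if "u \<in> ball 0 1" for u
    using moebius_in_unit_disc[OF \<rho>1] that by simp
  have "(\<lambda>u. (u - (- of_real \<rho>)) / (1 - cnj (- of_real \<rho>) * u)) holomorphic_on ball 0 1"
    using one_minus_mult_cnj_neq_0[OF \<rho>1] by (intro holomorphic_intros) auto
  then have hol_g: "g holomorphic_on ball 0 1"
    using holomorphic_on_compose_gen[OF _ hol] in_disc unfolding g_def o_def by blast
  then have B: "g has_fps_expansion B"
    unfolding B_def by (intro has_fps_expansion_fps_expansion) auto
  have B_bound: "cmod (fps_nth B i) \<le> 1 - cmod (f (of_real \<rho>)) ^ 2" if "i \<ge> 1" for i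
    using coeff_bound_unit_disc[OF hol_g _ B that] le in_disc by (simp add: g_def)
  have W: "\<omega> has_fps_expansion disc_shift_fps \<rho>"
  proof -
    define D where "D = fps_const (complex_of_real d) - fps_const (of_real \<rho>) * fps_X"
    have D0: "fps_nth D 0 \<noteq> 0" using d by (simp add: D_def)
    have "\<omega> has_fps_expansion fps_X / D"
      unfolding \<omega>_def D_def by (intro fps_expansion_intros) (use D0 in \<open>simp add: D_def\<close>)
    moreover have "fps_X / D = disc_shift_fps \<rho>"
    proof -
      have "D \<noteq> 0" using D0 by auto
      have "fps_X = disc_shift_fps \<rho> * D"
        using disc_shift_fps_eq[OF \<rho>] by (simp add: D_def d_def)
      then show ?thesis using \<open>D \<noteq> 0\<close> by (metis nonzero_mult_div_cancel_right)
    qed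
    ultimately show ?thesis by simp
  qed
  have "(g \<circ> \<omega>) has_fps_expansion (B oo disc_shift_fps \<rho>)"
    by (intro fps_expansion_intros B W) (simp add: disc_shift_fps_def)
  moreover have "eventually (\<lambda>h. (g \<circ> \<omega>) h = f (1 * h + of_real \<rho>)) (nhds 0)"
    using eventually_nhds_in_open[of "ball 0 (1 - \<rho>)" "0::complex"]
  proof (rule eventually_mono[OF _ ])
    fix h :: complex assume h: "h \<in> ball 0 (1 - \<rho>)"
    have nz: "of_real d - of_real \<rho> * h \<noteq> 0"
    proof
      assume "of_real d - of_real \<rho> * h = 0"
      then have "cmod (of_real d) = cmod (of_real \<rho> * h)" by simp
      then have "d = \<rho> * cmod h" using d \<rho> by (simp add: norm_mult)
      also have "\<dots> \<le> cmod h" using \<rho> by (simp add: mult_left_le_one_le)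
      also have "\<dots> < 1 - \<rho>" using h by simp
      finally show False using d by simp
    qed
    have d0: "complex_of_real d \<noteq> 0" using d by simp
    have 1: "1 + of_real \<rho> * \<omega> h = of_real d / (of_real d - of_real \<rho> * h)"
      using nz by (simp add: \<omega>_def field_simps)
    have 2: "\<omega> h + of_real \<rho> = (of_real \<rho> + h) * of_real d / (of_real d - of_real \<rho> * h)"
      using nz by (simp add: \<omega>_def d_def field_simps power2_eq_square)
    have "(\<omega> h + of_real \<rho>) / (1 + of_real \<rho> * \<omega> h) = of_real \<rho> + h"
      unfolding 1 2 using nz d0 by simp
    then show "(g \<circ> \<omega>) h = f (1 * h + of_real \<rho>)"
      by (simp add: g_def add.commute)
  qed (use \<rho> in auto)
  ultimately have exp: "(\<lambda>h. f (1 * h + of_real \<rho>)) has_fps_expansion (B oo disc_shift_fps \<rho>)"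
    using has_fps_expansion_cong by fast
  have "(deriv ^^ k) (\<lambda>h. f (1 * h + of_real \<rho>)) 0 = 1 ^ k * (deriv ^^ k) f (1 * 0 + of_real \<rho>)"
  proof (rule higher_deriv_compose_linear'[OF hol])
    fix h :: complex assume "h \<in> ball 0 (1 - \<rho>)"
    then show "1 * h + of_real \<rho> \<in> ball 0 1"
      using norm_triangle_ineq[of h "of_real \<rho>"] \<rho> by simp
  qed (use \<rho> in auto)
  then have "(deriv ^^ k) f (of_real \<rho>) / fact k = fps_nth (B oo disc_shift_fps \<rho>) k"
    using fps_nth_fps_expansion[OF exp, of k] by simp
  also have "\<dots> = (\<Sum>i=0..k. fps_nth B i * fps_nth (disc_shift_fps \<rho> ^ i) k)"
    by (rule fps_compose_nth)
  also have "\<dots> = (\<Sum>i=1..k. fps_nth B i * fps_nth (disc_shift_fps \<rho> ^ i) k)"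
    using k by (simp add: sum.atLeast_Suc_atMost fps_one_nth)
  finally have "cmod ((deriv ^^ k) f (of_real \<rho>) / fact k) \<le>
      (\<Sum>i=1..k. cmod (fps_nth B i) * cmod (fps_nth (disc_shift_fps \<rho> ^ i) k))"
    by (metis (mono_tags, lifting) norm_mult norm_sum sum.cong)
  also have "\<dots> \<le> (\<Sum>i=1..k. (1 - cmod (f (of_real \<rho>)) ^ 2) * cmod (fps_nth (disc_shift_fps \<rho> ^ i) k))"
    using B_bound by (intro sum_mono mult_right_mono) auto
  also have "\<dots> = (1 - cmod (f (of_real \<rho>)) ^ 2) * (1 / ((1 + \<rho>) * (1 - \<rho>) ^ k))"
    by (simp only: sum_distrib_left[symmetric] sum_disc_shift_powers[OF \<rho> k])
  finally show ?thesis by simp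
qed

section \<open>The inequality\<close>

lemma contractive_functional_id: "contractive_functional (\<lambda>x::complex. x)"
  by (simp add: contractive_functional_def scaleC_complex_def)

lemma nth_frechet_scaled_diagonal:
  assumes hol: "holomorphic_map_on F U" and "open U" and z: "z \<in> U"
  shows "nth_frechet k F z (replicate k (c *\<^sub>C x)) = c ^ k *\<^sub>C nth_frechet k F z (replicate k x)"
proof -
  have "bounded_cmultilinear k (nth_frechet k F z)"
    using multi_holomorphic_nth_frechet[OF hol \<open>open U\<close>, of k] z by (auto simp: multi_holomorphic_on_def)
  from bounded_cmultilinear_scaleC[OF this, of "[]" "replicate k x" c] show ?thesis
    by simp
qed

lemma unit_direction:
  fixes w :: "'a::complex_normed_vector"
  obtains x where "norm x \<le> 1" "w = of_real (norm w) *\<^sub>C x"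
proof (cases "w = 0")
  case True
  then show ?thesis by (intro that[of 0]) (auto simp: scaleC_of_real)
next
  case False
  then show ?thesis
    by (intro that[of "w /\<^sub>R norm w"]) (auto simp: scaleC_of_real)
qed

lemma scaleC_in_unit_ball:
  fixes x :: "'a::complex_normed_vector"
  assumes "norm x \<le> 1" "t \<in> ball 0 1"
  shows "0 + t *\<^sub>C x \<in> ball 0 1"
proof -
  have "cmod t * norm x \<le> cmod t" using assms by (intro mult_left_le) auto
  then show ?thesis using assms by (simp add: norm_scaleC)
qed

text \<open>
  This is \<open>ruscheweyh_inequality\<close> for the restriction of \<open>F\<close> to the line through \<open>w\<close>, at the point that
  corresponds to \<open>w\<close>.
\<close>

lemma taylor_coeff_bound:
  fixes F :: "'a::complex_banach \<Rightarrow> complex"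
  assumes hol: "holomorphic_map_on F (ball 0 1)" and F1: "F ` ball 0 1 \<subseteq> cball 0 1"
    and w: "norm w < 1" and k: "k \<ge> 1"
  shows "cmod (nth_frechet k F w (replicate k w) / fact k) \<le>
    (1 - cmod (F w) ^ 2) / (1 + norm w) * (norm w / (1 - norm w)) ^ k"
proof -
  obtain x where x: "norm x \<le> 1" and wx: "w = of_real (norm w) *\<^sub>C x"
    by (rule unit_direction)
  define \<rho> where "\<rho> = norm w"
  define f where "f t = F (0 + t *\<^sub>C x)" for t
  note in_ball = scaleC_in_unit_ball[OF x]
  have fF: "f (of_real \<rho>) = F w" using wx by (simp add: f_def \<rho>_def)
  have hol_f: "f holomorphic_on ball 0 1"
    unfolding f_def by (rule holomorphic_on_along_line[OF hol contractive_functional_id in_ball])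
  have "nth_frechet k F w (replicate k w) = of_real \<rho> ^ k * nth_frechet k F w (replicate k x)"
    using nth_frechet_scaled_diagonal[OF hol open_ball, of w k "of_real \<rho>" x] w wx
    by (simp add: scaleC_complex_def \<rho>_def)
  also have "nth_frechet k F w (replicate k x) = (deriv ^^ k) f (of_real \<rho>)"
    using higher_deriv_along_line[OF hol open_ball contractive_functional_id in_ball, of "of_real \<rho>" k] w wx
    by (simp add: f_def[abs_def] \<rho>_def)
  finally have "cmod (nth_frechet k F w (replicate k w) / fact k) =
      \<rho> ^ k * cmod ((deriv ^^ k) f (of_real \<rho>) / fact k)"
    by (simp add: norm_mult norm_divide norm_power \<rho>_def)
  also have "\<dots> \<le> \<rho> ^ k * ((1 - cmod (f (of_real \<rho>)) ^ 2) / ((1 + \<rho>) * (1 - \<rho>) ^ k))"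
  proof (intro mult_left_mono ruscheweyh_inequality[OF hol_f])
    show "cmod (f t) \<le> 1" if "t \<in> ball 0 1" for t
      using F1 in_ball[OF that] by (force simp: f_def)
  qed (use w k in \<open>auto simp: \<rho>_def\<close>)
  also have "\<dots> = (1 - cmod (F w) ^ 2) / (1 + \<rho>) * (\<rho> / (1 - \<rho>)) ^ k"
    by (simp add: fF power_divide)
  finally show ?thesis by (simp add: \<rho>_def)
qed

definition radius_gap :: "nat \<Rightarrow> real \<Rightarrow> real" where
  "radius_gap N x = 2 * x ^ N - (1 - x) ^ (N - 1) * (1 + x) * (1 - 2 * x)"

lemma radius_eq_iff: "radius_eq m N r \<longleftrightarrow> radius_gap N (r ^ m) = 0"
  by (simp add: radius_eq_def radius_gap_def power_mult)

text \<open>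
  The quotient on the left is the tail from \<open>N\<close> of the geometric series with ratio \<open>\<rho> / (1 - \<rho>)\<close>,
  which converges exactly for \<open>\<rho> < 1 / 2\<close>.
\<close>

lemma radius_gap_iff:
  assumes "0 \<le> \<rho>" "\<rho> < 1 / 2" "N \<ge> 1"
  shows "2 * ((\<rho> / (1 - \<rho>)) ^ N / (1 - \<rho> / (1 - \<rho>))) \<le> 1 + \<rho> \<longleftrightarrow> radius_gap N \<rho> \<le> 0"
proof -
  obtain n where N: "N = Suc n" using assms(3) by (cases N) auto
  have "1 - \<rho> / (1 - \<rho>) = (1 - 2 * \<rho>) / (1 - \<rho>)"
    using assms by (simp add: field_simps)
  then have "(\<rho> / (1 - \<rho>)) ^ N / (1 - \<rho> / (1 - \<rho>)) = \<rho> ^ N / ((1 - \<rho>) ^ n * (1 - 2 * \<rho>))"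
    using assms by (simp add: power_divide N)
  moreover have "2 * (\<rho> ^ N / ((1 - \<rho>) ^ n * (1 - 2 * \<rho>))) \<le> 1 + \<rho> \<longleftrightarrow>
      2 * \<rho> ^ N \<le> (1 + \<rho>) * ((1 - \<rho>) ^ n * (1 - 2 * \<rho>))"
    using assms by (subst pos_divide_le_eq[symmetric]) auto
  ultimately show ?thesis
    by (simp add: radius_gap_def N mult_ac)
qed

lemma radius_gap_strict_mono:
  assumes "0 \<le> x" "x < y" "y \<le> 1 / 2" "N \<ge> 1"
  shows "radius_gap N x < radius_gap N y"
proof -
  have "x ^ N < y ^ N" using assms by (intro power_strict_mono) auto
  moreover have "(1 - y) ^ (N - 1) * ((1 + y) * (1 - 2 * y)) \<le> (1 - x) ^ (N - 1) * ((1 + x) * (1 - 2 * x))"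
  proof (rule mult_mono)
    show "(1 - y) ^ (N - 1) \<le> (1 - x) ^ (N - 1)"
      using assms by (intro power_mono) auto
    have "0 \<le> (y - x) * (1 + 2 * (x + y))" using assms by (intro mult_nonneg_nonneg) auto
    then show "(1 + y) * (1 - 2 * y) \<le> (1 + x) * (1 - 2 * x)" by (simp add: algebra_simps)
  qed (use assms in auto)
  ultimately show ?thesis
    unfolding radius_gap_def mult.assoc by linarith
qed

lemma radius_gap_root:
  assumes N: "N \<ge> 1"
  obtains x where "0 < x" "x < 1 / 2" "radius_gap N x = 0"
proof -
  have "\<exists>x. 0 \<le> x \<and> x \<le> 1 / 2 \<and> radius_gap N x = 0"
  proof (rule IVT')
    show "continuous_on {0..1 / 2} (radius_gap N)"
      unfolding radius_gap_def by (intro continuous_intros)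
  qed (use N in \<open>auto simp: radius_gap_def power_0_left\<close>)
  then obtain x where x: "0 \<le> x" "x \<le> 1 / 2" "radius_gap N x = 0" by blast
  moreover have "radius_gap N 0 \<noteq> 0" "radius_gap N (1 / 2) \<noteq> 0"
    using N by (auto simp: radius_gap_def power_0_left)
  then have "x \<noteq> 0" "x \<noteq> 1 / 2" using x(3) by metis+
  ultimately show ?thesis by (intro that[of x]) auto
qed

lemma bohr_sum_le_1:
  fixes F :: "'a::complex_banach \<Rightarrow> complex"
  assumes F: "disc_mapping F" and N: "N \<ge> 1" and w: "norm w < 1 / 2" and gap: "radius_gap N (norm w) \<le> 0"
  shows "bohr_sum N F w \<le> 1"
proof -
  define \<rho> b q where "\<rho> = norm w" and "b = cmod (F w)" and "q = \<rho> / (1 - \<rho>)"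
  have \<rho>: "0 \<le> \<rho>" "\<rho> < 1 / 2" using w by (auto simp: \<rho>_def)
  then have q: "0 \<le> q" "q < 1" by (auto simp: q_def field_simps)
  have hol: "holomorphic_map_on F (ball 0 1)" and F1: "F ` ball 0 1 \<subseteq> cball 0 1"
    using F by (auto simp: disc_mapping_def)
  have b: "0 \<le> b" "b \<le> 1"
    using F1 w by (auto simp: b_def image_subset_iff)
  then have b2: "0 \<le> 1 - b ^ 2" by (simp add: power_le_one)
  define C where "C = (1 - b ^ 2) / (1 + \<rho>)"
  have C: "C \<ge> 0" using b2 \<rho> by (simp add: C_def)
  define S where "S = C * (q ^ N / (1 - q))"
  have "(\<lambda>k. C * q ^ N * q ^ k) sums (C * q ^ N * (1 / (1 - q)))"
    using q by (intro sums_mult geometric_sums) auto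
  then have sums: "(\<lambda>k. C * q ^ (k + N)) sums S"
    by (simp add: S_def power_add mult_ac)
  have "(\<Sum>k. ennreal (cmod (nth_frechet (k + N) F w (replicate (k + N) w) / fact (k + N))))
      \<le> (\<Sum>k. ennreal (C * q ^ (k + N)))"
  proof (intro suminf_le summableI ennreal_leI)
    fix k
    show "cmod (nth_frechet (k + N) F w (replicate (k + N) w) / fact (k + N)) \<le> C * q ^ (k + N)"
      using taylor_coeff_bound[OF hol F1, of w "k + N"] w N by (simp add: C_def b_def q_def \<rho>_def)
  qed
  also have "\<dots> = ennreal S"
    using C q sums by (intro suminf_ennreal_eq) auto
  finally have "bohr_sum N F w \<le> ennreal b + ennreal S"
    unfolding bohr_sum_def b_def by (intro add_left_mono)
  also have "\<dots> = ennreal (b + S)"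
    using b C q by (intro ennreal_plus[symmetric]) (auto simp: S_def)
  also have "\<dots> \<le> ennreal 1"
  proof (rule ennreal_leI)
    have "2 * (q ^ N / (1 - q)) \<le> 1 + \<rho>"
      using radius_gap_iff[OF \<rho> N] gap by (simp add: q_def \<rho>_def)
    then have "C * (2 * (q ^ N / (1 - q))) \<le> C * (1 + \<rho>)"
      using C by (rule mult_left_mono)
    moreover have "C * (1 + \<rho>) = 1 - b ^ 2" "C * (2 * (q ^ N / (1 - q))) = 2 * S"
      using \<rho> by (auto simp: C_def S_def)
    ultimately have "2 * S \<le> 1 - b ^ 2" by simp
    moreover have "0 \<le> (1 - b) ^ 2" by simp
    ultimately show "b + S \<le> 1"
      by (simp add: power2_eq_square algebra_simps)
  qed
  finally show ?thesis by simp
qed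

text \<open>
  A functional that norms \<open>\<mu> z\<close>, restricted to the line through \<open>z\<close>, gives a function on the disc whose
  derivatives at \<open>0\<close> of order less than \<open>m\<close> vanish.
\<close>

lemma schwarz_mapping_norm_le:
  assumes \<mu>: "schwarz_mapping \<mu>" and ord: "zero_of_order m \<mu>" and z: "norm z < 1"
  shows "norm (\<mu> z) \<le> norm z ^ m"
proof -
  have hol: "holomorphic_map_on \<mu> (ball 0 1)" and \<mu>1: "\<mu> ` ball 0 1 \<subseteq> ball 0 1"
    using \<mu> by (auto simp: schwarz_mapping_def)
  obtain x where x: "norm x \<le> 1" and zx: "z = of_real (norm z) *\<^sub>C x"
    by (rule unit_direction)
  obtain \<psi> where \<psi>: "contractive_functional \<psi>" and \<psi>z: "\<psi> (\<mu> z) = of_real (norm (\<mu> z))"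
    by (rule norming_functional)
  define f where "f t = \<psi> (\<mu> (0 + t *\<^sub>C x))" for t
  note in_ball = scaleC_in_unit_ball[OF x]
  have hol_f: "f holomorphic_on ball 0 1"
    unfolding f_def by (rule holomorphic_on_along_line[OF hol \<psi> in_ball])
  then have exp: "f has_fps_expansion fps_expansion f 0"
    by (intro has_fps_expansion_fps_expansion) auto
  have "(\<forall>t\<in>ball 0 1. cmod (f t) \<le> cmod t ^ m) \<and> cmod (fps_nth (fps_expansion f 0) m) \<le> 1"
  proof (rule schwarz_higher_order[OF hol_f _ exp])
    fix t :: complex assume t: "t \<in> ball 0 1"
    have "cmod (f t) \<le> norm (\<mu> (0 + t *\<^sub>C x))"
      unfolding f_def by (rule contractive_functional_simps(3)[OF \<psi>])
    also have "\<dots> \<le> 1"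
      using \<mu>1 in_ball[OF t] by (force simp: image_subset_iff)
    finally show "cmod (f t) \<le> 1" .
  next
    fix j assume "j < m"
    then have "nth_frechet j \<mu> 0 (replicate j x) = 0"
      using ord by (simp add: zero_of_order_def)
    then have "(deriv ^^ j) f 0 = 0"
      using higher_deriv_along_line[OF hol open_ball \<psi> in_ball, of 0 j]
      by (simp add: f_def[abs_def] contractive_functional_simps(5)[OF \<psi>])
    then show "fps_nth (fps_expansion f 0) j = 0"
      by (simp add: fps_expansion_def)
  qed
  then have "cmod (f (of_real (norm z))) \<le> norm z ^ m"
    using z by (auto dest: bspec[of _ _ "complex_of_real (norm z)"])
  moreover have "f (of_real (norm z)) = of_real (norm (\<mu> z))"
    using zx \<psi>z by (simp add: f_def)
  ultimately show ?thesis by simp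
qed

lemma holomorphic_map_taylor_sums:
  fixes F :: "'a::complex_banach \<Rightarrow> complex"
  assumes hol: "holomorphic_map_on F (ball 0 1)" and z: "z \<in> ball 0 1"
  shows "(\<lambda>s. taylor_poly F (Suc s) z) sums (F z - F 0)"
proof -
  define f where "f t = F (0 + t *\<^sub>C z)" for t
  \<comment> \<open>any \<open>r > 1\<close> with \<open>r * norm z < 1\<close>: the point \<open>t = 1\<close> must be interior to the disc\<close>
  define r where "r = 2 / (1 + norm z)"
  have r: "r > 1" "r * norm z < 1"
    using z by (auto simp: r_def field_simps add_pos_nonneg)
  have in_ball: "0 + t *\<^sub>C z \<in> ball 0 1" if "t \<in> ball 0 r" for t
  proof -
    have "cmod t * norm z \<le> r * norm z" using that by (intro mult_right_mono) auto
    then show ?thesis using r by (simp add: norm_scaleC)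
  qed
  have "f holomorphic_on ball 0 r"
    unfolding f_def by (rule holomorphic_on_along_line[OF hol contractive_functional_id in_ball])
  then have "(\<lambda>n. (deriv ^^ n) f 0 / fact n * (1 - 0) ^ n) sums f 1"
    using r by (intro holomorphic_power_series) auto
  moreover have "(deriv ^^ n) f 0 / fact n * (1 - 0) ^ n = taylor_poly F n z" for n
    using higher_deriv_along_line[OF hol open_ball contractive_functional_id in_ball, of 0 n] r
    by (simp add: f_def[abs_def] taylor_poly_def)
  ultimately have "(\<lambda>n. taylor_poly F n z) sums F z"
    by (simp add: f_def scaleC_one)
  from sums_split_initial_segment[OF this, of 1] show ?thesis
    by (simp add: taylor_poly_def)
qed

section \<open>Sharpness\<close>

lemma holomorphic_map_scaleC:
  assumes p: "holomorphic_map_on p U" and g: "holomorphic_map_on g U"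
  shows "holomorphic_map_on (\<lambda>z. p z *\<^sub>C g z) U"
proof (rule holomorphic_map_onI)
  fix z assume z: "z \<in> U"
  show "((\<lambda>z. p z *\<^sub>C g z) has_derivative (\<lambda>h. p z *\<^sub>C frechet_D g z h + frechet_D p z h *\<^sub>C g z)) (at z)"
    by (rule bounded_bilinear.FDERIV[OF bounded_bilinear_scaleC
          holomorphic_map_has_derivative[OF p z] holomorphic_map_has_derivative[OF g z]])
  show "p z *\<^sub>C frechet_D g z (c *\<^sub>C x) + frechet_D p z (c *\<^sub>C x) *\<^sub>C g z =
      c *\<^sub>C (p z *\<^sub>C frechet_D g z x + frechet_D p z x *\<^sub>C g z)" for c x
    by (simp add: frechet_D_scaleC[OF p z] frechet_D_scaleC[OF g z] scaleC_add_right scaleC_scaleC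
        scaleC_complex_def mult.commute)
qed

lemma holomorphic_map_id: "holomorphic_map_on (\<lambda>z. z) U"
  by (rule holomorphic_map_onI[where L = "\<lambda>z h. h"]) auto

lemma holomorphic_map_of_functional:
  assumes \<psi>: "contractive_functional \<psi>" and f: "f holomorphic_on ball 0 1"
  shows "holomorphic_map_on (\<lambda>z. f (\<psi> z)) (ball 0 1)"
proof (rule holomorphic_map_onI)
  fix z :: 'a assume z: "z \<in> ball 0 1"
  have "cmod (\<psi> z) < 1"
    using contractive_functional_simps(3)[OF \<psi>, of z] z by simp
  then have "(f has_field_derivative deriv f (\<psi> z)) (at (\<psi> z))"
    by (intro holomorphic_derivI[OF f]) auto
  then have "(f has_derivative (*) (deriv f (\<psi> z))) (at (\<psi> z))"
    by (simp add: has_field_derivative_def)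
  from has_derivative_compose[OF bounded_linear_imp_has_derivative[OF bounded_linear_contractive[OF \<psi>]] this]
  show "((\<lambda>z. f (\<psi> z)) has_derivative (\<lambda>h. deriv f (\<psi> z) * \<psi> h)) (at z)" .
  show "deriv f (\<psi> z) * \<psi> (c *\<^sub>C x) = c *\<^sub>C (deriv f (\<psi> z) * \<psi> x)" for c x
    by (simp add: contractive_functional_simps(2)[OF \<psi>] scaleC_complex_def)
qed

lemma disc_mapping_of_functional:
  assumes \<psi>: "contractive_functional (\<psi> :: 'a::complex_banach \<Rightarrow> complex)"
    and f: "f holomorphic_on ball 0 1" and f1: "\<And>t. cmod t < 1 \<Longrightarrow> cmod (f t) \<le> 1"
  shows "disc_mapping (\<lambda>z. f (\<psi> z))"
proof -
  have hol: "holomorphic_map_on (\<lambda>z. f (\<psi> z)) (ball 0 1)"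
    by (rule holomorphic_map_of_functional[OF \<psi> f])
  moreover have "cmod (\<psi> z) < 1" if "norm z < 1" for z
    using contractive_functional_simps(3)[OF \<psi>, of z] that by simp
  ultimately show ?thesis
    using f1 holomorphic_map_taylor_sums[OF hol] by (auto simp: disc_mapping_def)
qed

text \<open>
  By Cauchy's estimate on the ball of radius \<open>r\<close> about \<open>z\<close>, every differentiation costs one power of
  \<open>r\<close>. Stating the bound for every \<open>r \<ge> norm z\<close> instead of for \<open>r = norm z\<close> keeps the point \<open>z = 0\<close>
  within reach.
\<close>

lemma nth_frechet_small_near_0:
  fixes \<mu> :: "'a::complex_banach \<Rightarrow> 'b::complex_banach"
  assumes hol: "holomorphic_map_on \<mu> (ball 0 1)"
    and bound: "\<And>z. norm z < 1 \<Longrightarrow> norm (\<mu> z) \<le> norm z ^ m" and "j \<le> m"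
  shows "\<exists>C \<epsilon>. 0 \<le> C \<and> 0 < \<epsilon> \<and> \<epsilon> \<le> 1 \<and> (\<forall>z r ws. norm z \<le> r \<longrightarrow> 0 < r \<longrightarrow> r < \<epsilon> \<longrightarrow> length ws = j \<longrightarrow>
    norm (nth_frechet j \<mu> z ws) \<le> C * r ^ (m - j) * (\<Prod>w\<leftarrow>ws. norm w))"
  using \<open>j \<le> m\<close>
proof (induction j)
  case 0
  have "norm (\<mu> z) \<le> r ^ m" if "norm z \<le> r" "r < 1" for z r
    using bound[of z] power_mono[OF that(1), of m] that by simp
  then show ?case by (intro exI[of _ 1]) auto
next
  case (Suc j)
  then obtain C \<epsilon> where C: "0 \<le> C" and \<epsilon>: "0 < \<epsilon>" "\<epsilon> \<le> 1"
    and IH: "\<And>z r ws. norm z \<le> r \<Longrightarrow> 0 < r \<Longrightarrow> r < \<epsilon> \<Longrightarrow> length ws = j \<Longrightarrow>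
      norm (nth_frechet j \<mu> z ws) \<le> C * r ^ (m - j) * (\<Prod>w\<leftarrow>ws. norm w)"
    by (auto simp del: nth_frechet.simps)
  note G = multi_holomorphic_nth_frechet[OF hol open_ball, of j]
  obtain i where i: "m - j = Suc i" "m - Suc j = i"
    using Suc.prems by (metis Suc_diff_Suc Suc_le_lessD)
  have "norm (nth_frechet (Suc j) \<mu> z ws) \<le> (2 * C * 2 ^ Suc i) * r ^ i * (\<Prod>w\<leftarrow>ws. norm w)"
    if z: "norm z \<le> r" "0 < r" "r < \<epsilon> / 2" and ws: "length ws = Suc j" for z r ws
  proof -
    obtain h vs where vs: "ws = h # vs" "length vs = j"
      using ws by (auto simp: length_Suc_conv)
    have near: "norm y \<le> 2 * r" if "y \<in> ball z r" for y
      using that z norm_triangle_ineq[of "y - z" z] by (simp add: dist_norm norm_minus_commute)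
    have sub: "ball z r \<subseteq> ball 0 1"
      using near z \<epsilon> by fastforce
    have "nth_frechet (Suc j) \<mu> z ws = frechet_D (\<lambda>z. nth_frechet j \<mu> z vs) z h"
      using nth_frechet_Suc(2)[OF G open_ball, of z vs h] vs \<epsilon> z by (simp del: nth_frechet.simps)
    also have "norm \<dots> \<le> 2 * (C * (2 * r) ^ Suc i * (\<Prod>w\<leftarrow>vs. norm w)) / r * norm h"
    proof (rule cauchy_estimate_map)
      show "holomorphic_map_on (\<lambda>z. nth_frechet j \<mu> z vs) (ball z r)"
        using G vs sub by (auto simp: multi_holomorphic_on_def intro: holomorphic_map_on_subset)
      show "norm (nth_frechet j \<mu> y vs) \<le> C * (2 * r) ^ Suc i * (\<Prod>w\<leftarrow>vs. norm w)" if "y \<in> ball z r" for y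
        using IH[OF near[OF that], of vs] z vs by (simp add: i)
    qed (use z in auto)
    also have "\<dots> = (2 * C * 2 ^ Suc i) * r ^ i * (\<Prod>w\<leftarrow>ws. norm w)"
      using z by (simp add: vs power_mult_distrib)
    finally show ?thesis .
  qed
  then show ?case
    using C \<epsilon> unfolding i
    by (intro exI[of _ "2 * C * 2 ^ Suc i"] exI[of _ "\<epsilon> / 2"]) (auto simp del: nth_frechet.simps)
qed

text \<open>
  Let \<open>r \<rightarrow> 0\<close> in the previous bound at \<open>z = 0\<close>. It covers all argument lists, not only the diagonal ones
  that restriction to complex lines can reach.
\<close>

lemma nth_frechet_0_vanishes:
  fixes \<mu> :: "'a::complex_banach \<Rightarrow> 'b::complex_banach"
  assumes hol: "holomorphic_map_on \<mu> (ball 0 1)"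
    and bound: "\<And>z. norm z < 1 \<Longrightarrow> norm (\<mu> z) \<le> norm z ^ m" and "j < m" "length ws = j"
  shows "nth_frechet j \<mu> 0 ws = 0"
proof -
  obtain C \<epsilon> where \<epsilon>: "0 < \<epsilon>" and le: "\<And>r. 0 < r \<Longrightarrow> r < \<epsilon> \<Longrightarrow>
      norm (nth_frechet j \<mu> 0 ws) \<le> C * r ^ (m - j) * (\<Prod>w\<leftarrow>ws. norm w)"
    using nth_frechet_small_near_0[OF hol bound, of j] assms(3,4) by (metis less_imp_le norm_zero)
  have "norm (nth_frechet j \<mu> 0 ws) \<le> C * 0 ^ (m - j) * (\<Prod>w\<leftarrow>ws. norm w)"
  proof (rule tendsto_le[of "at_right (0::real)"])
    show "((\<lambda>r. C * r ^ (m - j) * (\<Prod>w\<leftarrow>ws. norm w)) \<longlongrightarrow> C * 0 ^ (m - j) * (\<Prod>w\<leftarrow>ws. norm w)) (at_right 0)"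
      by (intro tendsto_intros)
    show "\<forall>\<^sub>F r in at_right 0. norm (nth_frechet j \<mu> 0 ws) \<le> C * r ^ (m - j) * (\<Prod>w\<leftarrow>ws. norm w)"
      using eventually_at_right_real[OF \<epsilon>] by (auto elim!: eventually_mono intro: le)
  qed auto
  moreover have "(0::real) ^ (m - j) = 0" using \<open>j < m\<close> by simp
  ultimately have "norm (nth_frechet j \<mu> 0 ws) \<le> 0" by (simp only: mult_zero_left mult_zero_right)
  then show ?thesis by simp
qed

text \<open>
  Derivatives of order less than \<open>m\<close> vanish at \<open>0\<close> because \<open>\<mu>\<close> is of size \<open>norm z ^ m\<close>. The \<open>m\<close>-th one
  does not, because \<open>\<psi> (\<mu> (s x)) = s\<^sup>m\<close> along the line through \<open>x\<close>.
\<close>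

lemma zero_of_order_functional_power:
  fixes \<psi> :: "'a::complex_banach \<Rightarrow> complex"
  assumes \<psi>: "contractive_functional \<psi>" and x: "\<psi> x = 1" and m: "m \<ge> 1"
  defines "\<mu> \<equiv> \<lambda>z. \<psi> z ^ (m - 1) *\<^sub>C z"
  shows "schwarz_mapping \<mu>" "zero_of_order m \<mu>"
proof -
  obtain n where n: "m = Suc n" using m by (cases m) auto
  have hol: "holomorphic_map_on \<mu> (ball 0 1)"
    unfolding \<mu>_def
    by (intro holomorphic_map_scaleC holomorphic_map_id holomorphic_map_of_functional[OF \<psi>] holomorphic_intros)
  have bound: "norm (\<mu> z) \<le> norm z ^ m" for z
  proof -
    have "cmod (\<psi> z) ^ n * norm z \<le> norm z ^ n * norm z"
      using contractive_functional_simps(3)[OF \<psi>, of z] by (intro mult_right_mono power_mono) auto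
    then show ?thesis by (simp add: \<mu>_def n norm_scaleC norm_power mult.commute)
  qed
  have "norm (\<mu> z) < 1" if "norm z < 1" for z
    using bound[of z] power_le_one[of "norm z" n] that mult_left_le[of "norm z ^ n" "norm z"]
    by (simp add: n)
  moreover have "\<mu> 0 = 0"
    using bound[of 0] by (simp add: n)
  ultimately show "schwarz_mapping \<mu>"
    using hol by (auto simp: schwarz_mapping_def)
  have "\<psi> (\<mu> (0 + s *\<^sub>C x)) = s ^ m" for s
    by (simp add: \<mu>_def n contractive_functional_simps[OF \<psi>] x mult.commute)
  then have "\<psi> (nth_frechet m \<mu> 0 (replicate m x)) = (deriv ^^ m) (\<lambda>s. s ^ m) 0"
    using higher_deriv_along_line[OF hol open_ball \<psi>, of 0 0 x m] by simp
  moreover have "fps_nth (fps_X ^ m) m = (deriv ^^ m) (\<lambda>s. s ^ m) 0 / (fact m :: complex)"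
    by (intro fps_nth_fps_expansion fps_expansion_intros)
  ultimately have "\<psi> (nth_frechet m \<mu> 0 (replicate m x)) \<noteq> 0"
    by (auto simp: fps_X_power_nth)
  then have "nth_frechet m \<mu> 0 (replicate m x) \<noteq> 0"
    using contractive_functional_simps(5)[OF \<psi>] by metis
  then show "zero_of_order m \<mu>"
    unfolding zero_of_order_def using nth_frechet_0_vanishes[OF hol bound]
    by (auto intro!: exI[of _ "replicate m x"])
qed

lemma one_minus_mult_neq_0:
  assumes "0 < a" "a < 1" "cmod t < 1"
  shows "1 - complex_of_real a * t \<noteq> 0"
  using one_minus_mult_cnj_neq_0[of "of_real a" t] assms by simp

lemma higher_deriv_extremal:
  assumes a: "0 < a" "a < 1" and t: "t \<in> ball 0 1"
  defines "f \<equiv> \<lambda>t. (complex_of_real a - t) / (1 - complex_of_real a * t)"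
  shows "(deriv ^^ Suc k) f t = - (fact (Suc k) * (1 - of_real a ^ 2) * of_real a ^ k / (1 - of_real a * t) ^ (k + 2))"
  using t
proof (induction k arbitrary: t)
  case 0
  then have "1 - complex_of_real a * t \<noteq> 0" using one_minus_mult_neq_0[OF a] by simp
  then have "(f has_field_derivative - ((1 - of_real a ^ 2) / (1 - of_real a * t) ^ 2)) (at t)"
    unfolding f_def
    by (auto intro!: derivative_eq_intros simp: divide_simps power2_eq_square algebra_simps)
  then have "deriv f t = - ((1 - of_real a ^ 2) / (1 - of_real a * t) ^ 2)"
    by (rule DERIV_imp_deriv)
  then show ?case by (simp add: power2_eq_square)
next
  case (Suc k)
  define c where "c = fact (Suc k) * (1 - complex_of_real a ^ 2) * of_real a ^ k"
  have nz: "1 - complex_of_real a * t \<noteq> 0" using one_minus_mult_neq_0[OF a] Suc.prems by simp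
  have "((\<lambda>t. (1 - of_real a * t) ^ (k + 2)) has_field_derivative
      of_nat (k + 2) * (1 - of_real a * t) ^ (k + 1) * (- of_real a)) (at t)"
  proof -
    have "((\<lambda>t. 1 - of_real a * t) has_field_derivative - of_real a) (at t)"
      by (auto intro!: derivative_eq_intros)
    from DERIV_power[OF this, of "k + 2"] show ?thesis by (simp add: mult_ac)
  qed
  note der = DERIV_cmult[OF DERIV_inverse'[OF this], of "- c"]
  have alg: "- c * - (inverse (u ^ (k + 2)) * (p * u ^ (k + 1) * (- b)) * inverse (u ^ (k + 2))) =
      - (c * p * b / u ^ (k + 3))" if "u \<noteq> 0" for u p b :: complex
    using that by (simp add: field_simps power_add eval_nat_numeral)
  have "((\<lambda>t. - c * inverse ((1 - of_real a * t) ^ (k + 2))) has_field_derivative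
      - (c * of_nat (k + 2) * of_real a / (1 - of_real a * t) ^ (k + 3))) (at t)"
    by (rule DERIV_cong[OF der alg]) (use nz in auto)
  then have "((deriv ^^ Suc k) f has_field_derivative
      - (c * of_nat (k + 2) * of_real a / (1 - of_real a * t) ^ (k + 3))) (at t)"
    by (rule has_field_derivative_transform_within_open[OF _ open_ball Suc.prems])
      (use Suc.IH in \<open>simp add: c_def divide_inverse\<close>)
  then have "(deriv ^^ Suc (Suc k)) f t = - (c * of_nat (k + 2) * of_real a / (1 - of_real a * t) ^ (k + 3))"
    by (auto dest: DERIV_imp_deriv)
  then show ?case by (simp add: c_def mult_ac eval_nat_numeral)
qed

text \<open>
  For the extremal map the summands form an exact geometric series with ratio \<open>q\<close>, which tends to
  the ratio \<open>\<rho> / (1 - \<rho>)\<close> of the upper bound as \<open>a \<rightarrow> 1\<close>.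
\<close>

lemma bohr_sum_extremal:
  fixes \<psi> :: "'a::complex_banach \<Rightarrow> complex"
  assumes \<psi>: "contractive_functional \<psi>" and x: "norm x \<le> 1" "\<psi> x = 1"
    and a: "0 < a" "a < 1" and \<rho>: "0 \<le> \<rho>" "\<rho> < 1 / 2" and N: "N \<ge> 1"
  defines "f \<equiv> \<lambda>t. (complex_of_real a - t) / (1 - complex_of_real a * t)"
    and "q \<equiv> a * \<rho> / (1 - a * \<rho>)"
  shows "bohr_sum N (\<lambda>z. f (\<psi> z)) (of_real \<rho> *\<^sub>C x) =
    ennreal (cmod (f (of_real \<rho>)) + (1 - a ^ 2) / (a * (1 - a * \<rho>)) * (q ^ N / (1 - q)))"
proof -
  define F where "F = (\<lambda>z. f (\<psi> z))"
  define w where "w = complex_of_real \<rho> *\<^sub>C x"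
  define C where "C = (1 - a ^ 2) / (a * (1 - a * \<rho>))"
  have a\<rho>: "a * \<rho> < 1 / 2" "0 \<le> a * \<rho>"
    using a \<rho> mult_left_le_one_le[of \<rho> a] by auto
  have q: "0 \<le> q" "q < 1"
    using a\<rho> by (auto simp: q_def field_simps)
  have C: "0 \<le> C"
    using a a\<rho> by (auto simp: C_def power_le_one)
  have w_ball: "w \<in> ball 0 1" "0 + of_real \<rho> *\<^sub>C x \<in> ball 0 1"
    using x \<rho> mult_left_le[of "norm x" \<rho>] by (auto simp: w_def norm_scaleC)
  have hol: "holomorphic_map_on F (ball 0 1)"
    unfolding F_def f_def using one_minus_mult_neq_0[OF a]
    by (intro holomorphic_map_of_functional[OF \<psi>] holomorphic_intros) auto
  have "F (0 + s *\<^sub>C x) = f s" for s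
    by (simp add: F_def contractive_functional_simps[OF \<psi>] x)
  then have deriv: "nth_frechet k F w (replicate k x) = (deriv ^^ k) f (of_real \<rho>)" for k
    using higher_deriv_along_line[OF hol open_ball contractive_functional_id w_ball(2), of k]
    by (simp add: w_def)
  have coeff: "cmod (nth_frechet k F w (replicate k w) / fact k) = C * q ^ k" if k: "k \<ge> 1" for k
  proof -
    obtain j where j: "k = Suc j" using k by (cases k) auto
    define e where "e = 1 - a * \<rho>"
    have e: "e > 0" "1 - complex_of_real a * of_real \<rho> = of_real e"
      using a\<rho> by (auto simp: e_def)
    have "nth_frechet k F w (replicate k w) = of_real \<rho> ^ k * (deriv ^^ k) f (of_real \<rho>)"
      using nth_frechet_scaled_diagonal[OF hol open_ball w_ball(1), of k "of_real \<rho>" x] deriv[of k]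
      by (simp add: scaleC_complex_def w_def)
    also have "(deriv ^^ k) f (of_real \<rho>) = - (fact k * (1 - of_real a ^ 2) * of_real a ^ j / of_real e ^ (j + 2))"
      unfolding j f_def e(2)[symmetric] using \<rho> by (intro higher_deriv_extremal[OF a]) auto
    also have "of_real \<rho> ^ k * (- (fact k * (1 - of_real a ^ 2) * of_real a ^ j / of_real e ^ (j + 2)))
        = - (fact k * complex_of_real (\<rho> ^ k * ((1 - a ^ 2) * a ^ j / e ^ (j + 2))))"
      by simp
    finally have "cmod (nth_frechet k F w (replicate k w) / fact k) =
        cmod (complex_of_real (\<rho> ^ k * ((1 - a ^ 2) * a ^ j / e ^ (j + 2))))"
      by (simp add: norm_divide norm_mult)
    also have "\<dots> = \<rho> ^ k * ((1 - a ^ 2) * a ^ j / e ^ (j + 2))"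
      unfolding norm_of_real using a \<rho> e by (intro abs_of_nonneg) (auto simp: power_le_one)
    also have "\<dots> = C * q ^ k"
      unfolding C_def q_def e_def[symmetric] j
      using a e(1) by (simp add: power_mult_distrib power_divide)
    finally show ?thesis .
  qed
  have "(\<lambda>k. C * q ^ N * q ^ k) sums (C * q ^ N * (1 / (1 - q)))"
    using q by (intro sums_mult geometric_sums) auto
  then have sums: "(\<lambda>k. C * q ^ (k + N)) sums (C * (q ^ N / (1 - q)))"
    by (simp add: power_add mult_ac)
  have "bohr_sum N F w = ennreal (cmod (F w)) + (\<Sum>k. ennreal (C * q ^ (k + N)))"
    unfolding bohr_sum_def using N by (simp only: coeff trans_le_add2)
  also have "(\<Sum>k. ennreal (C * q ^ (k + N))) = ennreal (C * (q ^ N / (1 - q)))"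
    using C q sums by (intro suminf_ennreal_eq) auto
  also have "ennreal (cmod (F w)) + ennreal (C * (q ^ N / (1 - q))) = ennreal (cmod (F w) + C * (q ^ N / (1 - q)))"
    using C q by (intro ennreal_plus[symmetric]) auto
  also have "F w = f (of_real \<rho>)"
    by (simp add: F_def w_def contractive_functional_simps[OF \<psi>] x)
  finally show ?thesis by (simp only: F_def w_def C_def)
qed

text \<open>
  Both the deficit \<open>1 - (a - \<rho>) / (1 - a \<rho>)\<close> and the tail are multiples of \<open>(1 - a) / (1 - a \<rho>)\<close>. After
  division by this factor the former is \<open>1 + \<rho>\<close>, and the latter tends to twice the geometric tail of
  \<open>radius_gap_iff\<close>, which exceeds \<open>1 + \<rho>\<close> because the gap is positive.
\<close>

lemma extremal_parameter:
  assumes \<rho>: "0 \<le> \<rho>" "\<rho> < 1 / 2" and N: "N \<ge> 1" and gap: "radius_gap N \<rho> > 0"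
  obtains a where "0 < a" "a < 1"
    "1 < (a - \<rho>) / (1 - a * \<rho>) +
      (1 - a ^ 2) / (a * (1 - a * \<rho>)) * ((a * \<rho> / (1 - a * \<rho>)) ^ N / (1 - a * \<rho> / (1 - a * \<rho>)))"
proof -
  define h where "h a = (1 + a) / a * ((a * \<rho> / (1 - a * \<rho>)) ^ N / (1 - a * \<rho> / (1 - a * \<rho>)))" for a
  have "1 - \<rho> / (1 - \<rho>) \<noteq> 0" using \<rho> by (simp add: field_simps)
  then have "(h \<longlongrightarrow> (1 + 1) / 1 * ((1 * \<rho> / (1 - 1 * \<rho>)) ^ N / (1 - 1 * \<rho> / (1 - 1 * \<rho>)))) (at_left 1)"
    unfolding h_def using \<rho> by (intro tendsto_intros) auto
  moreover have "1 + \<rho> < (1 + 1) / 1 * ((1 * \<rho> / (1 - 1 * \<rho>)) ^ N / (1 - 1 * \<rho> / (1 - 1 * \<rho>)))"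
    using radius_gap_iff[OF \<rho> N] gap by simp
  ultimately have "\<forall>\<^sub>F a in at_left 1. 1 + \<rho> < h a"
    by (rule order_tendstoD)
  then have "\<forall>\<^sub>F a in at_left 1. 1 + \<rho> < h a \<and> a \<in> {0<..<1}"
    using eventually_at_left_real[of 0 "1::real"] by (simp add: eventually_conj)
  then obtain a where a: "1 + \<rho> < h a" "0 < a" "a < 1"
    using eventually_happens[of _ "at_left (1::real)"] by (auto simp: trivial_limit_at_left_real)
  have e: "0 < 1 - a * \<rho>"
    using a \<rho> mult_left_le_one_le[of \<rho> a] by auto
  have "(1 - a) / (1 - a * \<rho>) * (1 + \<rho>) < (1 - a) / (1 - a * \<rho>) * h a"
    using a e by (intro mult_strict_left_mono) auto
  moreover have "(1 - a) / (1 - a * \<rho>) * (1 + \<rho>) = 1 - (a - \<rho>) / (1 - a * \<rho>)"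
    using e by (simp add: field_simps)
  moreover have "(1 - a) / (1 - a * \<rho>) * h a = (1 - a ^ 2) / (a * (1 - a * \<rho>)) *
      ((a * \<rho> / (1 - a * \<rho>)) ^ N / (1 - a * \<rho> / (1 - a * \<rho>)))"
  proof -
    have "(1 - a) / (1 - a * \<rho>) * ((1 + a) / a) = (1 - a ^ 2) / (a * (1 - a * \<rho>))"
      using a e by (simp add: field_simps power2_eq_square)
    then show ?thesis unfolding h_def mult.assoc[symmetric] by simp
  qed
  ultimately show ?thesis
    using a by (intro that[of a]) auto
qed

lemma bohr_inequality_fails:
  fixes \<psi> :: "'a::complex_banach \<Rightarrow> complex"
  assumes \<psi>: "contractive_functional \<psi>" and x: "norm x \<le> 1" "\<psi> x = 1"
    and \<rho>: "0 \<le> \<rho>" "\<rho> < 1 / 2" and N: "N \<ge> 1" and gap: "radius_gap N \<rho> > 0"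
  obtains F where "disc_mapping F" "\<not> bohr_sum N F (of_real \<rho> *\<^sub>C x) \<le> 1"
proof -
  obtain a where a: "0 < a" "a < 1" and gt: "1 < (a - \<rho>) / (1 - a * \<rho>) +
      (1 - a ^ 2) / (a * (1 - a * \<rho>)) * ((a * \<rho> / (1 - a * \<rho>)) ^ N / (1 - a * \<rho> / (1 - a * \<rho>)))"
    using extremal_parameter[OF \<rho> N gap] by blast
  define f where "f t = (complex_of_real a - t) / (1 - complex_of_real a * t)" for t
  show ?thesis
  proof (rule that[of "\<lambda>z. f (\<psi> z)"])
    show "disc_mapping (\<lambda>z. f (\<psi> z))"
    proof (rule disc_mapping_of_functional[OF \<psi>])
      show "f holomorphic_on ball 0 1"
        unfolding f_def using one_minus_mult_neq_0[OF a] by (intro holomorphic_intros) auto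
      fix t :: complex assume "cmod t < 1"
      then have "cmod ((t - of_real a) / (1 - cnj (of_real a) * t)) < 1"
        using a by (intro moebius_in_unit_disc) auto
      then show "cmod (f t) \<le> 1"
        by (simp add: f_def norm_divide norm_minus_commute)
    qed
    have "f (of_real \<rho>) = of_real ((a - \<rho>) / (1 - a * \<rho>))"
      by (simp add: f_def)
    then have "(a - \<rho>) / (1 - a * \<rho>) \<le> cmod (f (of_real \<rho>))"
      by (metis abs_ge_self norm_of_real)
    then have "1 < cmod (f (of_real \<rho>)) +
        (1 - a ^ 2) / (a * (1 - a * \<rho>)) * ((a * \<rho> / (1 - a * \<rho>)) ^ N / (1 - a * \<rho> / (1 - a * \<rho>)))"
      using gt by linarith
    then show "\<not> bohr_sum N (\<lambda>z. f (\<psi> z)) (of_real \<rho> *\<^sub>C x) \<le> 1"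
      using bohr_sum_extremal[OF \<psi> x a \<rho> N] by (simp add: f_def[abs_def] ennreal_le_1)
  qed
qed

section \<open>The radius\<close>

theorem theorem3p3:
  fixes m N :: nat
  assumes "m \<ge> 1" and "N \<ge> 1"
  shows "\<exists>R. R \<in> {0<..<1} \<and> smallest_positive_root m N R \<and>
    (\<forall>(F :: 'a::complex_banach \<Rightarrow> complex) \<mu>.
        disc_mapping F \<and> schwarz_mapping \<mu> \<and> zero_of_order m \<mu> \<longrightarrow>
        (\<forall>z\<in>ball 0 1. norm z \<le> R \<longrightarrow> bohr_sum N F (\<mu> z) \<le> 1)) \<and>
    ((\<exists>x::'a. x \<noteq> 0) \<longrightarrow>
      (\<forall>R'>R. \<not> (\<forall>(F :: 'a \<Rightarrow> complex) \<mu>.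
        disc_mapping F \<and> schwarz_mapping \<mu> \<and> zero_of_order m \<mu> \<longrightarrow>
        (\<forall>z\<in>ball 0 1. norm z \<le> R' \<longrightarrow> bohr_sum N F (\<mu> z) \<le> 1))))"
proof -
  obtain x0 where x0: "0 < x0" "x0 < 1 / 2" "radius_gap N x0 = 0"
    by (rule radius_gap_root[OF \<open>N \<ge> 1\<close>])
  define R where "R = root m x0"
  have R: "0 < R" "R < 1" "R ^ m = x0"
    using x0 \<open>m \<ge> 1\<close> by (auto simp: R_def)
  have gap_le: "radius_gap N \<rho> \<le> 0" if "0 \<le> \<rho>" "\<rho> \<le> x0" for \<rho>
    using radius_gap_strict_mono[of \<rho> x0 N] that x0 \<open>N \<ge> 1\<close> by (cases "\<rho> = x0") auto
  have smallest: "smallest_positive_root m N R"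
    unfolding smallest_positive_root_def radius_eq_iff
  proof (intro conjI allI impI)
    fix r :: real assume r: "0 < r" "radius_gap N (r ^ m) = 0"
    show "R \<le> r"
    proof (rule ccontr)
      assume "\<not> R \<le> r"
      then have "r ^ m < x0"
        unfolding R(3)[symmetric] using r \<open>m \<ge> 1\<close> by (intro power_strict_mono) auto
      then show False
        using radius_gap_strict_mono[of "r ^ m" x0 N] r x0 \<open>N \<ge> 1\<close> by simp
    qed
  qed (use R x0 in auto)
  have inequality: "bohr_sum N F (\<mu> z) \<le> 1"
    if "disc_mapping F" "schwarz_mapping \<mu>" "zero_of_order m \<mu>" "norm z < 1" "norm z \<le> R"
    for F :: "'a \<Rightarrow> complex" and \<mu> z
  proof -
    have "norm (\<mu> z) \<le> norm z ^ m"
      using that by (intro schwarz_mapping_norm_le) auto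
    also have "\<dots> \<le> x0"
      unfolding R(3)[symmetric] using that by (intro power_mono) auto
    finally show ?thesis
      using that x0 \<open>N \<ge> 1\<close> gap_le[of "norm (\<mu> z)"] by (intro bohr_sum_le_1) auto
  qed
  have sharp: "\<exists>(F :: 'a \<Rightarrow> complex) \<mu> z. disc_mapping F \<and> schwarz_mapping \<mu> \<and> zero_of_order m \<mu> \<and>
      norm z < 1 \<and> norm z \<le> R' \<and> \<not> bohr_sum N F (\<mu> z) \<le> 1"
    if y: "y \<noteq> 0" and R': "R' > R" for y :: 'a and R'
  proof -
    define x where "x = y /\<^sub>R norm y"
    have x: "norm x = 1" using y by (simp add: x_def)
    obtain \<psi> where \<psi>: "contractive_functional \<psi>" "\<psi> x = 1"
      using norming_functional[of x] x by auto
    have "x0 < R' ^ m"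
      unfolding R(3)[symmetric] using R R' \<open>m \<ge> 1\<close> by (intro power_strict_mono) auto
    then obtain \<rho> where \<rho>: "x0 < \<rho>" "\<rho> < 1 / 2" "\<rho> < R' ^ m"
      using dense[of x0 "min (1 / 2) (R' ^ m)"] x0 by auto
    define r where "r = root m \<rho>"
    have r: "0 < r" "r < 1" "r ^ m = \<rho>"
      using \<rho> x0 \<open>m \<ge> 1\<close> by (auto simp: r_def)
    have "r \<le> R'"
      using \<rho> r R R' power_mono_iff[of r R' m] \<open>m \<ge> 1\<close> by auto
    have gap: "radius_gap N \<rho> > 0"
      using radius_gap_strict_mono[of x0 \<rho> N] \<rho> x0 \<open>N \<ge> 1\<close> by simp
    have "norm x \<le> 1" "0 \<le> \<rho>" using x x0 \<rho> by auto
    then obtain F where F: "disc_mapping F" "\<not> bohr_sum N F (of_real \<rho> *\<^sub>C x) \<le> 1"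
      using bohr_inequality_fails[OF \<psi>(1) _ \<psi>(2) _ \<rho>(2) \<open>N \<ge> 1\<close> gap] by blast
    define \<mu> where "\<mu> z = \<psi> z ^ (m - 1) *\<^sub>C z" for z
    define z where "z = complex_of_real r *\<^sub>C x"
    have "complex_of_real r ^ (m - 1) * of_real r = of_real (r ^ m)"
      using \<open>m \<ge> 1\<close> by (cases m) auto
    then have "\<mu> z = of_real \<rho> *\<^sub>C x"
      using r by (simp add: \<mu>_def z_def contractive_functional_simps[OF \<psi>(1)] \<psi>(2) scaleC_scaleC)
    moreover have "norm z = r" using x r by (simp add: z_def norm_scaleC)
    ultimately show ?thesis
      using F zero_of_order_functional_power[OF \<psi> \<open>m \<ge> 1\<close>] r \<open>r \<le> R'\<close>
      by (intro exI[of _ F] exI[of _ \<mu>] exI[of _ z]) (auto simp: \<mu>_def[abs_def])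
  qed
  show ?thesis
  proof (intro exI[of _ R] conjI impI allI notI)
    fix R' assume "\<exists>x::'a. x \<noteq> 0" "R' > R"
    then obtain F :: "'a \<Rightarrow> complex" and \<mu> z where "disc_mapping F" "schwarz_mapping \<mu>" "zero_of_order m \<mu>"
      "norm z < 1" "norm z \<le> R'" "\<not> bohr_sum N F (\<mu> z) \<le> 1"
      using sharp by blast
    moreover assume "\<forall>(F :: 'a \<Rightarrow> complex) \<mu>. disc_mapping F \<and> schwarz_mapping \<mu> \<and> zero_of_order m \<mu> \<longrightarrow>
        (\<forall>z\<in>ball 0 1. norm z \<le> R' \<longrightarrow> bohr_sum N F (\<mu> z) \<le> 1)"
    ultimately show False by auto
  qed (use R smallest inequality in auto)
qed

end
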